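(* Let $T>0$, suppose that $u\in C_0^2$ and that the solution $\eta$ of the problem \[ \eta_t+(u\eta)_x=0\ \ (0\le x\le1,\ 0\le t\le T),\qquad \eta(x,0)=\eta_0(x)\ \ (0\le x\le1), \] satisfies $\eta\in C(0,T;C^4)$. Let $\eta_h:[0,T]\to S_h^2$ be the solution of the semidiscrete problem \[ (\eta_{ht},\phi)+((u\eta_h)_x,\phi)=0\quad\forall\phi\in S_h^2,\ 0\le t\le T,\qquad \eta_h(0)=P\eta_0 . \] Then there is a constant $C$ independent of $h$ such that \[ \max_{0\le t\le T}\|\eta-\eta_h\|_\infty\le Ch^2 . \]
   Context: $C^k=C^k[0,1]$, $C_0^k=\{\phi\in C^k:\phi(0)=\phi(1)=0\}$. No boundary conditions are imposed on $\eta$. $C(0,T;X)$ is the space of functions $\phi=\phi(t)$ with values in the Banach space $X$ for each $t\in[0,T]$ and such that $t\mapsto\|\phi(t)\|_X$ is continuous on $[0,T]$. For an integer $N\ge2$, $h=1/N$, $x_i=(i-1)h$, $i=1,\dots,N+1$ (uniform mesh), $S_h^2=\{\phi\in C^0[0,1]:\phi|_{[x_j,x_{j+1}]}\in\mathbb P_1,\ 1\le j\le N\}$ ($\mathbb P_1$: polynomials of degree $\le1$). $(\cdot,\cdot)$ is the inner product of $L^2(0,1)$, $\|\cdot\|_\infty$ the norm of $L^\infty(0,1)$, and $P$ the $L^2$-projection onto $S_h^2$. *)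

theory Defs
  imports "HOL-Analysis.Analysis" "HOL-Probability.Essential_Supremum"
begin

text \<open>
  Functions on \<open>[0,1]\<close> are represented by functions on \<open>real\<close> whose values outside \<open>[0,1]\<close> are
  irrelevant; a function of \<open>t\<close> and \<open>x\<close> is represented by \<open>\<lambda>t x. \<dots>\<close>.
\<close>

subsection \<open>Function spaces\<close>

text \<open>The derivative is taken within \<open>[0,1]\<close>, hence one-sided at the end points.\<close>

definition deriv01 :: "(real \<Rightarrow> real) \<Rightarrow> real \<Rightarrow> real" where
  "deriv01 f x = vector_derivative f (at x within {0..1})"

definition Ck_space :: "nat \<Rightarrow> (real \<Rightarrow> real) set" where
  "Ck_space k = {f. (\<forall>j<k. (deriv01 ^^ j) f differentiable_on {0..1})
                  \<and> continuous_on {0..1} ((deriv01 ^^ k) f)}"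

definition Ck0_space :: "nat \<Rightarrow> (real \<Rightarrow> real) set" where
  "Ck0_space k = {f \<in> Ck_space k. f 0 = 0 \<and> f 1 = 0}"

definition Ck_norm :: "nat \<Rightarrow> (real \<Rightarrow> real) \<Rightarrow> real" where
  "Ck_norm k f = (MAX j\<in>{..k}. SUP x\<in>{0..1}. \<bar>(deriv01 ^^ j) f x\<bar>)"

text \<open>
  The space \<open>C(0,T;C\<^sup>k)\<close>. Continuity is required only of the norm \<open>t \<mapsto> \<parallel>\<phi>(t)\<parallel>\<close>, not of
  \<open>\<phi>\<close> as a map into \<open>C\<^sup>k\<close>.
\<close>

definition C_time_Ck :: "real \<Rightarrow> nat \<Rightarrow> (real \<Rightarrow> real \<Rightarrow> real) set" where
  "C_time_Ck T k = {\<phi>. (\<forall>t\<in>{0..T}. \<phi> t \<in> Ck_space k)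
                      \<and> continuous_on {0..T} (\<lambda>t. Ck_norm k (\<phi> t))}"

definition L2_inner :: "(real \<Rightarrow> real) \<Rightarrow> (real \<Rightarrow> real) \<Rightarrow> real" where
  "L2_inner f g = (LINT x|lebesgue_on {0<..<1}. f x * g x)"

text \<open>The norm is extended-real-valued, so that a finite bound includes essential boundedness.\<close>

definition Linf_norm :: "(real \<Rightarrow> real) \<Rightarrow> ereal" where
  "Linf_norm f = esssup (lebesgue_on {0<..<1}) (\<lambda>x. ereal \<bar>f x\<bar>)"

subsection \<open>The continuous problem\<close>

definition transport_solution ::
    "real \<Rightarrow> (real \<Rightarrow> real) \<Rightarrow> (real \<Rightarrow> real) \<Rightarrow> (real \<Rightarrow> real \<Rightarrow> real) \<Rightarrow> bool" where
  "transport_solution T u \<eta>0 \<eta> \<longleftrightarrow>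
     (\<forall>t\<in>{0..T}. \<forall>x\<in>{0..1}. \<exists>a b.
        ((\<lambda>s. \<eta> s x) has_real_derivative a) (at t within {0..T}) \<and>
        ((\<lambda>y. u y * \<eta> t y) has_real_derivative b) (at x within {0..1}) \<and>
        a + b = 0) \<and>
     (\<forall>x\<in>{0..1}. \<eta> 0 x = \<eta>0 x)"

subsection \<open>The semidiscrete problem\<close>

definition mesh :: "nat \<Rightarrow> nat \<Rightarrow> real" where
  "mesh N i = (real i - 1) * (1 / real N)"

definition Sh2 :: "nat \<Rightarrow> (real \<Rightarrow> real) set" where
  "Sh2 N = {\<phi>. continuous_on {0..1} \<phi> \<and>
      (\<forall>j\<in>{1..N}. \<exists>a b. \<forall>x\<in>{mesh N j..mesh N (j + 1)}. \<phi> x = a + b * x)}"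

text \<open>
  A relation rather than a function, because \<open>P v\<close> is determined only on \<open>[0,1]\<close>.
\<close>

definition is_L2_projection :: "nat \<Rightarrow> (real \<Rightarrow> real) \<Rightarrow> (real \<Rightarrow> real) \<Rightarrow> bool" where
  "is_L2_projection N v w \<longleftrightarrow>
     w \<in> Sh2 N \<and> (\<forall>\<phi>\<in>Sh2 N. L2_inner w \<phi> = L2_inner v \<phi>)"

text \<open>
  Since \<open>S\<^sub>h\<close> is finite-dimensional, the time derivative \<open>\<eta>ht\<close> may be taken pointwise in \<open>x\<close>.
  The \<open>x\<close>-derivative of \<open>u \<eta>h(t)\<close> exists except possibly at the finitely many mesh points,
  where the value of \<^const>\<open>deriv\<close> is arbitrary but does not affect the integral.
\<close>

definition semidiscrete_solution ::
    "nat \<Rightarrow> real \<Rightarrow> (real \<Rightarrow> real) \<Rightarrow> (real \<Rightarrow> real) \<Rightarrow> (real \<Rightarrow> real \<Rightarrow> real) \<Rightarrow> bool" where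
  "semidiscrete_solution N T u \<eta>0 \<eta>h \<longleftrightarrow>
     (\<forall>t\<in>{0..T}. \<eta>h t \<in> Sh2 N) \<and>
     (\<exists>\<eta>ht.
        (\<forall>t\<in>{0..T}. \<forall>x\<in>{0..1}.
           ((\<lambda>s. \<eta>h s x) has_real_derivative \<eta>ht t x) (at t within {0..T})) \<and>
        (\<forall>t\<in>{0..T}. \<forall>\<phi>\<in>Sh2 N.
           L2_inner (\<eta>ht t) \<phi> + L2_inner (deriv (\<lambda>y. u y * \<eta>h t y)) \<phi> = 0)) \<and>
     is_L2_projection N \<eta>0 (\<eta>h 0)"

end

theory Submission
  imports Defs
begin

text \<open>
  The scheme is stable in \<open>L\<^sup>2\<close>: for \<open>\<theta>\<close> in \<open>S\<^sub>h\<close> one has \<open>2 \<integral> u \<theta> \<theta>' = - \<integral> u' \<theta>\<^sup>2\<close>, because \<open>u\<close> vanishes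
  at both end points. Passing from \<open>L\<^sup>2\<close> to the maximum norm within \<open>S\<^sub>h\<close> costs a factor \<open>h\<^sup>-\<^sup>1\<^sup>/\<^sup>2\<close>
  (\<open>Sh2_sup_bound\<close>), so \<open>\<eta>\<^sub>h\<close> has to be compared with an element of \<open>S\<^sub>h\<close> from which its \<open>L\<^sup>2\<close>-distance
  is \<open>O(h\<^sup>5\<^sup>/\<^sup>2)\<close>, half a power better than the error of approximation.

  This element is the projection \<open>P \<eta>\<close>. For \<open>\<theta> = \<eta>\<^sub>h - P \<eta> = P (\<eta>\<^sub>h - \<eta>)\<close>, testing the two problems
  with \<open>\<theta>\<close> and integrating by parts gives \<open>d/dt \<parallel>\<theta>\<parallel>\<^sup>2 = 2 \<integral> u (\<eta>\<^sub>h - \<eta>) \<theta>'\<close>, and \<open>\<theta>\<close> is initially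
  zero. The projection commutes with differentiation in time, so only \<open>\<eta>\<^sub>t\<close> has to exist.

  To see that the right-hand side is small, take the piecewise linear interpolant \<open>W\<close> of
  \<open>\<eta> - (h\<^sup>2/12) \<eta>\<^sub>x\<^sub>x\<close> and write \<open>\<eta>\<^sub>h - \<eta> = \<theta> + e - \<rho>\<close> with \<open>e = P \<eta> - W\<close> and \<open>\<rho> = \<eta> - W\<close>. The
  correction is chosen so that \<open>\<rho>\<close>, although only \<open>O(h\<^sup>2)\<close>, is on each element an even function of
  mean zero plus an odd function of size \<open>O(h\<^sup>3)\<close> plus \<open>O(h\<^sup>4)\<close> (\<open>corrected_interpolation_defect\<close>).
  As \<open>u\<close> is affine up to \<open>O(h\<^sup>2)\<close>, the integral of \<open>u \<rho>\<close> over an element is therefore \<open>O(h\<^sup>5)\<close>.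
  The odd part makes the first moment of \<open>\<rho>\<close> over an element equal to \<open>h\<^sup>5 \<eta>\<^sub>x\<^sub>x\<^sub>x/180\<close> up to \<open>O(h\<^sup>6)\<close>, and
  since the mesh is uniform these contributions to \<open>\<parallel>e\<parallel>\<^sup>2 = (\<rho>, e)\<close> telescope and leave boundary
  values only. This gives \<open>\<parallel>e\<parallel>\<^sup>2 = O(h\<^sup>7)\<close> (\<open>projection_defect_bound\<close>). With the inverse inequality
  for \<open>\<theta>'\<close> one obtains \<open>d/dt \<parallel>\<theta>\<parallel>\<^sup>2 \<le> C \<parallel>\<theta>\<parallel>\<^sup>2 + C h\<^sup>5\<close> (\<open>energy_rate_bound\<close>), so \<open>\<parallel>\<theta>\<parallel>\<^sup>2 = O(h\<^sup>5)\<close> by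
  Gronwall's inequality, and in the maximum norm \<open>\<theta>\<close>, \<open>e\<close> and \<open>\<rho>\<close> are all \<open>O(h\<^sup>2)\<close>.

  Throughout, an element of \<open>S\<^sub>h\<close> is described on each mesh interval by its mean and its slope.
\<close>

section \<open>Uniform meshes and piecewise linear functions\<close>

definition node :: "nat \<Rightarrow> nat \<Rightarrow> real" where
  "node N j = real j / real N"

abbreviation elem :: "nat \<Rightarrow> nat \<Rightarrow> real set" where
  "elem N j \<equiv> {node N j..node N (Suc j)}"

definition midpt :: "nat \<Rightarrow> nat \<Rightarrow> real" where
  "midpt N j = (real j + 1/2) / real N"

definition mean :: "nat \<Rightarrow> (real \<Rightarrow> real) \<Rightarrow> nat \<Rightarrow> real" where
  "mean N \<phi> j = (\<phi> (node N j) + \<phi> (node N (Suc j))) / 2"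

definition slope :: "nat \<Rightarrow> (real \<Rightarrow> real) \<Rightarrow> nat \<Rightarrow> real" where
  "slope N \<phi> j = (\<phi> (node N (Suc j)) - \<phi> (node N j)) * real N"

definition hat :: "nat \<Rightarrow> nat \<Rightarrow> real \<Rightarrow> real" where
  "hat N i x = max 0 (1 - \<bar>real N * x - real i\<bar>)"

definition interpolant :: "nat \<Rightarrow> (real \<Rightarrow> real) \<Rightarrow> real \<Rightarrow> real" where
  "interpolant N w x = (\<Sum>i\<le>N. w (node N i) * hat N i x)"

lemma node_0 [simp]: "node N 0 = 0"
  by (simp add: node_def)

lemma node_N [simp]: "N > 0 \<Longrightarrow> node N N = 1"
  by (simp add: node_def)

lemma node_less: "N > 0 \<Longrightarrow> node N j < node N (Suc j)"
  by (simp add: node_def divide_strict_right_mono)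

lemma node_mono: "i \<le> j \<Longrightarrow> node N i \<le> node N j"
  by (simp add: node_def divide_right_mono)

lemma elem_subset: "N > 0 \<Longrightarrow> j < N \<Longrightarrow> elem N j \<subseteq> {0..1}"
  using node_mono[of 0 j N] node_mono[of "Suc j" N N] by auto

lemma elem_ends:
  assumes "N > 0"
  shows "node N j = midpt N j - 1 / real N / 2" "node N (Suc j) = midpt N j + 1 / real N / 2"
  using assms by (simp_all add: node_def midpt_def field_simps)

lemma elem_eq:
  assumes "N > 0"
  shows "elem N j = {midpt N j - 1 / real N / 2..midpt N j + 1 / real N / 2}"
  unfolding elem_ends(2)[OF assms] unfolding elem_ends(1)[OF assms] ..

lemma midpt_dist: "N > 0 \<Longrightarrow> x \<in> elem N j \<Longrightarrow> \<bar>x - midpt N j\<bar> \<le> 1 / real N / 2"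
  by (simp add: elem_eq abs_le_iff algebra_simps)

lemma elem_cover:
  assumes "N > 0" "x \<in> {0..1}"
  obtains j where "j < N" "x \<in> elem N j"
proof (cases "x = 1")
  case True
  with assms have "x \<in> elem N (N - 1)" "N - 1 < N"
    by (simp_all add: node_def)
  then show ?thesis using that by blast
next
  case False
  define j where "j = nat \<lfloor>real N * x\<rfloor>"
  have x: "0 \<le> x" "x < 1" using assms False by auto
  have j: "real j \<le> real N * x" "real N * x < real j + 1"
    using x by (simp_all add: j_def)
  have "real j < real N"
    using j(1) x assms(1) by (smt (verit) mult_less_cancel_left2 of_nat_0_less_iff)
  then have "j < N" by simp
  moreover have "x \<in> elem N j"
    using j assms(1) by (simp add: node_def field_simps)
  ultimately show ?thesis using that by blast
qed

lemma Sh2_iff: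
  assumes "N > 0"
  shows "\<phi> \<in> Sh2 N \<longleftrightarrow> continuous_on {0..1} \<phi> \<and>
           (\<forall>j<N. \<exists>a b. \<forall>x\<in>elem N j. \<phi> x = a + b * x)"
proof -
  have m: "mesh N (Suc j) = node N j" for j
    by (simp add: mesh_def node_def)
  have "{1..N} = Suc ` {..<N}"
    by (simp add: image_Suc_lessThan)
  then have "(\<forall>j\<in>{1..N}. Q j) \<longleftrightarrow> (\<forall>j<N. Q (Suc j))" for Q
    by auto
  then show ?thesis
    unfolding Sh2_def by (simp add: m)
qed

lemma Sh2_continuous: "\<phi> \<in> Sh2 N \<Longrightarrow> continuous_on {0..1} \<phi>"
  by (simp add: Sh2_def)

lemma Sh2_affine:
  assumes "N > 0" "\<phi> \<in> Sh2 N" "j < N"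
  obtains a b where "\<And>x. x \<in> elem N j \<Longrightarrow> \<phi> x = a + b * x"
proof -
  have "\<exists>a b. \<forall>x\<in>elem N j. \<phi> x = a + b * x"
    using assms by (simp add: Sh2_iff)
  then show ?thesis using that by auto
qed

lemma Sh2_on_elem:
  assumes "N > 0" "\<phi> \<in> Sh2 N" "j < N" "x \<in> elem N j"
  shows "\<phi> x = mean N \<phi> j + slope N \<phi> j * (x - midpt N j)"
proof -
  obtain a b where ab: "\<And>x. x \<in> elem N j \<Longrightarrow> \<phi> x = a + b * x"
    using Sh2_affine[OF assms(1-3)] by blast
  have "node N j \<in> elem N j" "node N (Suc j) \<in> elem N j"
    using node_less[OF assms(1), of j] by auto
  then have "\<phi> (node N j) = a + b * node N j" "\<phi> (node N (Suc j)) = a + b * node N (Suc j)"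
    using ab by blast+
  then show ?thesis
    using assms(1) ab[OF assms(4)]
    by (simp add: mean_def slope_def midpt_def node_def field_simps)
qed

lemma Sh2_zero: "N > 0 \<Longrightarrow> (\<lambda>x. 0) \<in> Sh2 N"
  by (auto simp: Sh2_iff intro!: exI[of _ 0])

lemma Sh2_lincomb:
  assumes "N > 0" "\<phi> \<in> Sh2 N" "\<psi> \<in> Sh2 N"
  shows "(\<lambda>x. c * \<phi> x + d * \<psi> x) \<in> Sh2 N"
proof -
  have "\<exists>a b. \<forall>x\<in>elem N j. c * \<phi> x + d * \<psi> x = a + b * x" if "j < N" for j
  proof -
    obtain a b where ab: "\<And>x. x \<in> elem N j \<Longrightarrow> \<phi> x = a + b * x"
      using Sh2_affine[OF assms(1,2) \<open>j < N\<close>] by blast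
    obtain a' b' where ab': "\<And>x. x \<in> elem N j \<Longrightarrow> \<psi> x = a' + b' * x"
      using Sh2_affine[OF assms(1,3) \<open>j < N\<close>] by blast
    have "c * \<phi> x + d * \<psi> x = (c*a+d*a') + (c*b+d*b') * x" if "x \<in> elem N j" for x
      using ab[OF that] ab'[OF that] by (simp add: algebra_simps)
    then show ?thesis by blast
  qed
  then show ?thesis
    using assms by (auto simp: Sh2_iff intro!: continuous_intros)
qed

lemma Sh2_add: "N > 0 \<Longrightarrow> \<phi> \<in> Sh2 N \<Longrightarrow> \<psi> \<in> Sh2 N \<Longrightarrow> (\<lambda>x. \<phi> x + \<psi> x) \<in> Sh2 N"
  using Sh2_lincomb[of N \<phi> \<psi> 1 1] by simp

lemma Sh2_diff: "N > 0 \<Longrightarrow> \<phi> \<in> Sh2 N \<Longrightarrow> \<psi> \<in> Sh2 N \<Longrightarrow> (\<lambda>x. \<phi> x - \<psi> x) \<in> Sh2 N"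
  using Sh2_lincomb[of N \<phi> \<psi> 1 "-1"] by simp

lemma Sh2_scale: "N > 0 \<Longrightarrow> \<phi> \<in> Sh2 N \<Longrightarrow> (\<lambda>x. c * \<phi> x) \<in> Sh2 N"
  using Sh2_lincomb[of N \<phi> \<phi> c 0] by simp

lemma Sh2_sum:
  assumes "N > 0" "\<And>i. i \<in> I \<Longrightarrow> f i \<in> Sh2 N"
  shows "(\<lambda>x. \<Sum>i\<in>I. c i * f i x) \<in> Sh2 N"
  using assms(2)
proof (induction I rule: infinite_finite_induct)
  case (insert i I)
  have "(\<lambda>x. c i * f i x) \<in> Sh2 N" "(\<lambda>x. \<Sum>i\<in>I. c i * f i x) \<in> Sh2 N"
    using insert Sh2_scale[OF assms(1)] by auto
  then show ?case using insert Sh2_add[OF assms(1)] by simp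
qed (use Sh2_zero[OF assms(1)] in auto)

text \<open>
  A piecewise linear function is its own nodal data, which is what makes \<open>Sh2 N\<close> finite-dimensional.
\<close>
lemma Sh2_eqI:
  assumes "N > 0" "\<phi> \<in> Sh2 N" "\<psi> \<in> Sh2 N" "\<And>j. j \<le> N \<Longrightarrow> \<phi> (node N j) = \<psi> (node N j)"
    and "x \<in> {0..1}"
  shows "\<phi> x = \<psi> x"
proof -
  obtain j where j: "j < N" "x \<in> elem N j" using elem_cover[OF assms(1,5)] by blast
  then have "mean N \<phi> j = mean N \<psi> j" "slope N \<phi> j = slope N \<psi> j"
    using assms(4)[of j] assms(4)[of "Suc j"] by (simp_all add: mean_def slope_def)
  then show ?thesis
    using Sh2_on_elem[OF assms(1,2) j] Sh2_on_elem[OF assms(1,3) j] by simp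
qed

lemma Sh2_cong:
  assumes "N > 0" "\<phi> \<in> Sh2 N" "\<And>x. x \<in> {0..1} \<Longrightarrow> \<psi> x = \<phi> x"
  shows "\<psi> \<in> Sh2 N"
proof -
  have "continuous_on {0..1} \<psi>"
    using assms(2,3) continuous_on_cong[of "{0..1}" "{0..1}" \<psi> \<phi>] Sh2_continuous by blast
  moreover have "\<exists>a b. \<forall>x\<in>elem N j. \<psi> x = a + b * x" if "j < N" for j
  proof -
    obtain a b where ab: "\<And>x. x \<in> elem N j \<Longrightarrow> \<phi> x = a + b * x"
      using Sh2_affine[OF assms(1,2) \<open>j < N\<close>] by blast
    have "\<psi> x = a + b * x" if "x \<in> elem N j" for x
      using ab[OF that] assms(3)[of x] elem_subset[OF assms(1) \<open>j < N\<close>] that by auto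
    then show ?thesis by blast
  qed
  ultimately show ?thesis using Sh2_iff[OF assms(1)] by blast
qed

lemma hat_node: "N > 0 \<Longrightarrow> hat N i (node N j) = (if i = j then 1 else 0)"
proof -
  assume "N > 0"
  then have "hat N i (node N j) = max 0 (1 - \<bar>real j - real i\<bar>)"
    by (simp add: hat_def node_def)
  moreover have "\<bar>real j - real i\<bar> \<ge> 1" if "i \<noteq> j"
    using that by linarith
  ultimately show ?thesis by auto
qed

text \<open>
  On each element the kink of the hat function lies at an end point or outside, so that the
  element is on one side of it; the four cases are the two elements that meet at node \<open>i\<close> and
  those to the left and to the right of its support.
\<close>
lemma hat_Sh2:
  assumes "N > 0"
  shows "hat N i \<in> Sh2 N"
proof -
  have "\<exists>a b. \<forall>x\<in>elem N j. hat N i x = a + b * x" for j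
  proof -
    have el: "real j \<le> real N * x \<and> real N * x \<le> real j + 1" if "x \<in> elem N j" for x
      using that assms by (simp add: node_def field_simps)
    consider "j = i" | "Suc j = i" | "Suc j < i" | "i < j" by linarith
    then show ?thesis
    proof cases
      case 1
      then have "hat N i x = (1 + real i) + (- real N) * x" if "x \<in> elem N j" for x
        using el[OF that] by (simp add: hat_def)
      then show ?thesis by blast
    next
      case 2
      then have "hat N i x = (1 - real i) + real N * x" if "x \<in> elem N j" for x
        using el[OF that] by (simp add: hat_def)
      then show ?thesis by blast
    next
      case 3
      then have "real j + 2 \<le> real i" by linarith
      then have "hat N i x = 0 + 0 * x" if "x \<in> elem N j" for x
        using el[OF that] by (simp add: hat_def)
      then show ?thesis by blast
    next
      case 4
      then have "real i + 1 \<le> real j" by linarith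
      then have "hat N i x = 0 + 0 * x" if "x \<in> elem N j" for x
        using el[OF that] by (simp add: hat_def)
      then show ?thesis by blast
    qed
  qed
  moreover have "continuous_on {0..1} (hat N i)"
    unfolding hat_def by (intro continuous_intros)
  ultimately show ?thesis using Sh2_iff[OF assms] by blast
qed

lemma interpolant_Sh2: "N > 0 \<Longrightarrow> interpolant N w \<in> Sh2 N"
  unfolding interpolant_def[abs_def] by (rule Sh2_sum) (auto intro: hat_Sh2)

lemma interpolant_node:
  assumes "N > 0" "j \<le> N"
  shows "interpolant N w (node N j) = w (node N j)"
  using assms by (simp add: interpolant_def hat_node if_distrib sum.delta' cong: if_cong)

lemma interpolant_Sh2_id:
  assumes "N > 0" "\<phi> \<in> Sh2 N" "x \<in> {0..1}"
  shows "interpolant N \<phi> x = \<phi> x"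
  using Sh2_eqI[OF assms(1) interpolant_Sh2[OF assms(1)] assms(2)] interpolant_node assms by blast

section \<open>Functions with bounded derivatives\<close>

lemma Ck_space_derivative:
  assumes "f \<in> Ck_space k" "j < k" "x \<in> {0..1}"
  shows "((deriv01 ^^ j) f has_real_derivative (deriv01 ^^ Suc j) f x) (at x within {0..1})"
proof -
  have "(deriv01 ^^ j) f differentiable (at x within {0..1})"
    using assms by (auto simp: Ck_space_def differentiable_on_def)
  then show ?thesis
    by (simp add: has_real_derivative_iff_has_vector_derivative deriv01_def vector_derivative_works)
qed

lemma Ck_space_continuous:
  assumes "f \<in> Ck_space k" "j \<le> k"
  shows "continuous_on {0..1} ((deriv01 ^^ j) f)"
proof (cases "j = k")
  case False
  then show ?thesis
    using assms by (intro differentiable_imp_continuous_on) (auto simp: Ck_space_def)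
qed (use assms in \<open>auto simp: Ck_space_def\<close>)

lemma Ck_space_mono: "f \<in> Ck_space k \<Longrightarrow> l \<le> k \<Longrightarrow> f \<in> Ck_space l"
  using Ck_space_continuous[of f k l] by (simp add: Ck_space_def)

definition derivs_bounded :: "nat \<Rightarrow> (real \<Rightarrow> real) \<Rightarrow> real \<Rightarrow> bool" where
  "derivs_bounded k f M \<longleftrightarrow> (\<forall>i\<le>k. \<forall>x\<in>{0..1}. \<bar>(deriv01 ^^ i) f x\<bar> \<le> M)"

lemma derivs_boundedD:
  "derivs_bounded k f M \<Longrightarrow> i \<le> k \<Longrightarrow> x \<in> {0..1} \<Longrightarrow> \<bar>(deriv01 ^^ i) f x\<bar> \<le> M"
  by (simp add: derivs_bounded_def)

lemma Ck_norm_bound: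
  assumes "f \<in> Ck_space k" "j \<le> k" "x \<in> {0..1}"
  shows "\<bar>(deriv01 ^^ j) f x\<bar> \<le> Ck_norm k f"
proof -
  have "continuous_on {0..1} (\<lambda>x. \<bar>(deriv01 ^^ j) f x\<bar>)"
    using Ck_space_continuous[OF assms(1,2)] by (intro continuous_intros)
  then have "compact ((\<lambda>x. \<bar>(deriv01 ^^ j) f x\<bar>) ` {0..1})"
    by (rule compact_continuous_image) auto
  then have "bdd_above ((\<lambda>x. \<bar>(deriv01 ^^ j) f x\<bar>) ` {0..1})"
    by (intro bounded_imp_bdd_above compact_imp_bounded)
  then have "\<bar>(deriv01 ^^ j) f x\<bar> \<le> (SUP x\<in>{0..1}. \<bar>(deriv01 ^^ j) f x\<bar>)"
    using assms(3) by (intro cSUP_upper)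
  also have "\<dots> \<le> Ck_norm k f"
    unfolding Ck_norm_def using assms(2) by (intro Max_ge) auto
  finally show ?thesis .
qed

lemma C_time_Ck_bounded:
  assumes "\<phi> \<in> C_time_Ck T k"
  obtains M where "\<And>t. t \<in> {0..T} \<Longrightarrow> derivs_bounded k (\<phi> t) M"
proof -
  have "compact ((\<lambda>t. Ck_norm k (\<phi> t)) ` {0..T})"
    using assms by (intro compact_continuous_image) (auto simp: C_time_Ck_def)
  then have "bdd_above ((\<lambda>t. Ck_norm k (\<phi> t)) ` {0..T})"
    by (intro bounded_imp_bdd_above compact_imp_bounded)
  then obtain M where "\<forall>y\<in>(\<lambda>t. Ck_norm k (\<phi> t)) ` {0..T}. y \<le> M"
    unfolding bdd_above_def by blast
  then have M: "Ck_norm k (\<phi> t) \<le> M" if "t \<in> {0..T}" for t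
    using that by blast
  have "\<bar>(deriv01 ^^ j) (\<phi> t) x\<bar> \<le> M" if "t \<in> {0..T}" "j \<le> k" "x \<in> {0..1}" for t j x
    using Ck_norm_bound[of "\<phi> t" k j x] M[of t] that assms by (fastforce simp: C_time_Ck_def)
  then show ?thesis using that unfolding derivs_bounded_def by blast
qed

section \<open>The corrected interpolant on one element\<close>

text \<open>
  Applied repeatedly, this is Taylor's theorem about \<open>m\<close> with a crude constant, for derivatives
  that are one-sided at the ends of the interval.
\<close>
lemma increment_bound_power:
  fixes g g' :: "real \<Rightarrow> real"
  assumes d: "\<And>x. x \<in> {a..b} \<Longrightarrow> (g has_real_derivative g' x) (at x within {a..b})"
    and m: "m \<in> {a..b}" and B: "\<And>x. x \<in> {a..b} \<Longrightarrow> \<bar>g' x\<bar> \<le> K * \<bar>x - m\<bar> ^ n"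
    and K: "K \<ge> 0" and x: "x \<in> {a..b}"
  shows "\<bar>g x - g m\<bar> \<le> K * \<bar>x - m\<bar> ^ Suc n"
proof -
  let ?S = "closed_segment m x"
  have sub: "?S \<subseteq> {a..b}"
    using m x by (auto simp: closed_segment_eq_real_ivl)
  have "norm (g x - g m) \<le> (K * \<bar>x - m\<bar> ^ n) * norm (x - m)"
  proof (rule field_differentiable_bound[of ?S])
    fix z assume z: "z \<in> ?S"
    show "(g has_field_derivative g' z) (at z within ?S)"
      using d[of z] z sub by (meson DERIV_subset subsetD)
    have "\<bar>z - m\<bar> \<le> \<bar>x - m\<bar>"
      using z by (auto simp: closed_segment_eq_real_ivl split: if_splits)
    then have "K * \<bar>z - m\<bar> ^ n \<le> K * \<bar>x - m\<bar> ^ n"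
      using K by (intro mult_left_mono power_mono) auto
    then show "norm (g' z) \<le> K * \<bar>x - m\<bar> ^ n"
      using B[of z] z sub by force
  qed auto
  then show ?thesis by (simp add: ac_simps)
qed

lemma has_integral_centered_poly:
  fixes m k :: real
  assumes "k \<ge> 0"
  shows "((\<lambda>x. a0 + a1*(x-m) + a2*(x-m)^2 + a3*(x-m)^3 + a4*(x-m)^4) has_integral
            (2*a0*k + 2/3*a2*k^3 + 2/5*a4*k^5)) {m-k..m+k}"
proof -
  let ?F = "\<lambda>x. a0*(x-m) + a1/2*(x-m)^2 + a2/3*(x-m)^3 + a3/4*(x-m)^4 + a4/5*(x-m)^5"
  have "((\<lambda>x. a0 + a1*(x-m) + a2*(x-m)^2 + a3*(x-m)^3 + a4*(x-m)^4) has_integral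
     (?F (m+k) - ?F (m-k))) {m-k..m+k}"
  proof (rule fundamental_theorem_of_calculus)
    show "(?F has_vector_derivative a0 + a1*(x-m) + a2*(x-m)^2 + a3*(x-m)^3 + a4*(x-m)^4)
      (at x within {m-k..m+k})" for x
      unfolding has_real_derivative_iff_has_vector_derivative[symmetric]
      by (auto intro!: derivative_eq_intros)
  qed (use assms in auto)
  moreover have "?F (m+k) - ?F (m-k) = 2*a0*k + 2/3*a2*k^3 + 2/5*a4*k^5"
    by (simp add: field_simps)
  ultimately show ?thesis by (simp only:)
qed

text \<open>
  The linear interpolant of \<open>w = f - (h\<^sup>2/12) f''\<close> in place of that of \<open>f\<close> removes the mean of the
  interpolation error. Write \<open>s = x - m\<close>. The interpolant of \<open>s\<^sup>2\<close> is \<open>h\<^sup>2/4\<close>, and the correction turns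
  the error into \<open>s\<^sup>2 - h\<^sup>2/12\<close>, which is orthogonal to all polynomials of degree at most 1. For \<open>s\<^sup>3\<close>
  one gets \<open>s\<^sup>3 - h\<^sup>2 s/4 + h\<^sup>2 s/2\<close>, an odd function. The Taylor remainders contribute \<open>O(h\<^sup>4)\<close>.
  The second claim is recorded for the comparison of \<open>f3\<close> at a node with its value at \<open>m\<close>.
\<close>
lemma corrected_interpolation_defect:
  fixes f f1 f2 f3 f4 :: "real \<Rightarrow> real"
  defines "I \<equiv> \<lambda>m h. {m - h/2..m + h/2 :: real}"
  assumes h: "0 < h"
    and d: "\<And>x. x \<in> I m h \<Longrightarrow> (f has_real_derivative f1 x) (at x within I m h)"
      "\<And>x. x \<in> I m h \<Longrightarrow> (f1 has_real_derivative f2 x) (at x within I m h)"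
      "\<And>x. x \<in> I m h \<Longrightarrow> (f2 has_real_derivative f3 x) (at x within I m h)"
      "\<And>x. x \<in> I m h \<Longrightarrow> (f3 has_real_derivative f4 x) (at x within I m h)"
    and M: "\<And>x. x \<in> I m h \<Longrightarrow> \<bar>f4 x\<bar> \<le> M"
    and w: "\<And>x. w x = f x - h\<^sup>2/12 * f2 x"
    and x: "x \<in> I m h"
  shows "\<bar>f x - ((w (m-h/2) + w (m+h/2))/2 + (w (m+h/2) - w (m-h/2))/h*(x-m))
          - (f2 m/2*((x-m)\<^sup>2 - h\<^sup>2/12) + f3 m/6*((x-m)^3 + h\<^sup>2/4*(x-m)))\<bar> \<le> M * h^4"
    and "\<bar>f3 x - f3 m\<bar> \<le> M * h"
proof -
  have mI: "m \<in> I m h" and aI: "m - h/2 \<in> I m h" and bI: "m + h/2 \<in> I m h"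
    using h by (auto simp: I_def)
  have M0: "M \<ge> 0" using M[OF mI] by linarith
  note mI' = mI[unfolded I_def] and d' = d[unfolded I_def]
  have b3: "\<bar>f3 x - f3 m\<bar> \<le> M * \<bar>x - m\<bar> ^ 1" if "x \<in> I m h" for x
    using increment_bound_power[OF d'(4) mI', of M 0 x] M M0 that by (simp add: I_def)
  \<comment> \<open>\<open>r2\<close>, \<open>r1\<close>, \<open>r0\<close> are the Taylor remainders of \<open>f''\<close>, \<open>f'\<close>, \<open>f\<close>; each is a primitive of the one before.\<close>
  define r2 where "r2 = (\<lambda>x. f2 x - f2 m - f3 m * (x-m))"
  have b2: "\<bar>r2 x\<bar> \<le> M * \<bar>x - m\<bar> ^ 2" if "x \<in> I m h" for x
  proof -
    have "(r2 has_real_derivative f3 x - f3 m) (at x within {m-h/2..m+h/2})"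
      if "x \<in> {m-h/2..m+h/2}" for x
      unfolding r2_def by (rule derivative_eq_intros d'(3)[OF that] refl | simp)+
    from increment_bound_power[OF this mI', of M 1 x] b3 M0 that show ?thesis
      by (simp add: I_def r2_def eval_nat_numeral)
  qed
  define r1 where "r1 = (\<lambda>x. f1 x - f1 m - f2 m * (x-m) - f3 m / 2 * (x-m)^2)"
  have b1: "\<bar>r1 x\<bar> \<le> M * \<bar>x - m\<bar> ^ 3" if "x \<in> I m h" for x
  proof -
    have "(r1 has_real_derivative r2 x) (at x within {m-h/2..m+h/2})"
      if "x \<in> {m-h/2..m+h/2}" for x
      unfolding r1_def r2_def by (rule derivative_eq_intros d'(2)[OF that] refl | simp)+
    from increment_bound_power[OF this mI', of M 2 x] b2 M0 that show ?thesis
      by (simp add: I_def r1_def eval_nat_numeral)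
  qed
  define r0 where "r0 = (\<lambda>x. f x - f m - f1 m * (x-m) - f2 m / 2 * (x-m)^2 - f3 m / 6 * (x-m)^3)"
  have b0: "\<bar>r0 x\<bar> \<le> M * \<bar>x - m\<bar> ^ 4" if "x \<in> I m h" for x
  proof -
    have "(r0 has_real_derivative r1 x) (at x within {m-h/2..m+h/2})"
      if "x \<in> {m-h/2..m+h/2}" for x
      unfolding r0_def r1_def by (rule derivative_eq_intros d'(1)[OF that] refl | simp)+
    from increment_bound_power[OF this mI', of M 3 x] b1 M0 that show ?thesis
      by (simp add: I_def r0_def eval_nat_numeral)
  qed
  have xm: "\<bar>x - m\<bar> \<le> h/2" if "x \<in> I m h" for x using that unfolding I_def atLeastAtMost_iff by linarith
  have r0h: "\<bar>r0 x\<bar> \<le> M * h^4 / 16" if "x \<in> I m h" for x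
  proof -
    have "M * \<bar>x - m\<bar> ^ 4 \<le> M * (h/2)^4"
      using xm[OF that] M0 by (intro mult_left_mono power_mono) auto
    then show ?thesis using b0[OF that] by (simp add: power_divide)
  qed
  have r2h: "\<bar>r2 x\<bar> \<le> M * h^2 / 4" if "x \<in> I m h" for x
  proof -
    have "M * \<bar>x - m\<bar> ^ 2 \<le> M * (h/2)^2"
      using xm[OF that] M0 by (intro mult_left_mono power_mono) auto
    then show ?thesis using b2[OF that] by (simp add: power_divide)
  qed
  \<comment> \<open>The part of \<open>w\<close> due to the remainders; its linear interpolant is a convex combination of two values of \<open>\<delta>\<close>.\<close>
  define \<delta> where "\<delta> = (\<lambda>x. r0 x - h\<^sup>2/12 * r2 x)"
  have \<delta>: "\<bar>\<delta> x\<bar> \<le> M * h^4 / 12" if "x \<in> I m h" for x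
  proof -
    have "\<bar>h\<^sup>2/12 * r2 x\<bar> = h\<^sup>2/12 * \<bar>r2 x\<bar>" by (simp add: abs_mult)
    also have "\<dots> \<le> h\<^sup>2/12 * (M * h^2 / 4)" by (intro mult_left_mono r2h[OF that]) auto
    also have "\<dots> = M * h^4/48" by (simp add: eval_nat_numeral)
    finally show ?thesis using r0h[OF that] unfolding \<delta>_def by linarith
  qed
  define c where "c = (x - m) / h"
  have c: "\<bar>c\<bar> \<le> 1/2" and xc: "x - m = h * c"
    using xm[OF x] h by (auto simp: c_def abs_divide field_simps)
  let ?da = "\<delta> (m-h/2)" let ?db = "\<delta> (m+h/2)"
  have eq: "f x - ((w (m-h/2) + w (m+h/2))/2 + (w (m+h/2) - w (m-h/2))/h*(x-m))
          - (f2 m/2*((x-m)\<^sup>2 - h\<^sup>2/12) + f3 m/6*((x-m)^3 + h\<^sup>2/4*(x-m)))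
     = r0 x - (?da * (1/2 - c) + ?db * (1/2 + c))"
    unfolding w \<delta>_def r0_def r2_def xc using h
    by (simp add: field_simps) (simp add: eval_nat_numeral algebra_simps)
  have "\<bar>?da * (1/2 - c)\<bar> \<le> (M*h^4/12) * (1/2 - c)" "\<bar>?db * (1/2 + c)\<bar> \<le> (M*h^4/12) * (1/2 + c)"
    unfolding abs_mult using \<delta>[OF aI] \<delta>[OF bI] c by (intro mult_mono; linarith)+
  moreover have "(M*h^4/12) * (1/2 - c) + (M*h^4/12) * (1/2 + c) = M*h^4/12"
    by (simp flip: distrib_left)
  moreover have "M*h^4 \<ge> 0" using M0 by simp
  ultimately show "\<bar>f x - ((w (m-h/2) + w (m+h/2))/2 + (w (m+h/2) - w (m-h/2))/h*(x-m))
          - (f2 m/2*((x-m)\<^sup>2 - h\<^sup>2/12) + f3 m/6*((x-m)^3 + h\<^sup>2/4*(x-m)))\<bar> \<le> M * h^4"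
    unfolding eq using r0h[OF x] by linarith
  have "M * \<bar>x - m\<bar> ^ 1 \<le> M * h"
    using xm[OF x] h M0 by (intro mult_left_mono) auto
  then show "\<bar>f3 x - f3 m\<bar> \<le> M * h" using b3[OF x] by linarith
qed

text \<open>
  The leading part \<open>p\<close> has mean zero, and its first moment comes from the odd cubic alone:
  \<open>\<integral> s (s\<^sup>3 + h\<^sup>2 s/4) ds = h\<^sup>5/30\<close>, hence \<open>h\<^sup>5 d3 / 180\<close>.
\<close>
lemma defect_moments:
  fixes \<rho> :: "real \<Rightarrow> real" and d2 d3 :: real
  defines "p \<equiv> \<lambda>m h x. d2/2*((x-m)\<^sup>2 - h\<^sup>2/12) + d3/6*((x-m)^3 + h\<^sup>2/4*(x-m))"
  assumes h: "0 < h" "h \<le> 1" and M: "\<bar>d2\<bar> \<le> M" "\<bar>d3\<bar> \<le> M"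
    and cont: "continuous_on {m - h/2..m + h/2} \<rho>"
    and \<rho>: "\<And>x. x \<in> {m - h/2..m + h/2} \<Longrightarrow> \<bar>\<rho> x - p m h x\<bar> \<le> M * h^4"
  shows "x \<in> {m - h/2..m + h/2} \<Longrightarrow> \<bar>\<rho> x\<bar> \<le> 2 * M * h\<^sup>2"
    and "\<bar>integral {m - h/2..m + h/2} \<rho>\<bar> \<le> M * h^5"
    and "\<bar>integral {m - h/2..m + h/2} (\<lambda>x. (x-m) * \<rho> x) - h^5 * d3 / 180\<bar> \<le> M * h^6"
proof -
  let ?I = "{m - h/2..m + h/2}"
  have M0: "M \<ge> 0" using M(1) by linarith
  have xm: "\<bar>x - m\<bar> \<le> h/2" if "x \<in> ?I" for x using that unfolding atLeastAtMost_iff by linarith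
  have pc: "continuous_on ?I (p m h)" unfolding p_def by (intro continuous_intros) auto
  show "\<bar>\<rho> x\<bar> \<le> 2 * M * h\<^sup>2" if x: "x \<in> ?I" for x
  proof -
    have "\<bar>x-m\<bar>^2 \<le> (h/2)^2" using xm[OF x] by (intro power_mono) auto
    then have sq: "(x-m)^2 \<le> h^2/4" by (simp add: power_divide)
    have cu: "\<bar>x-m\<bar>^3 \<le> (h/2)^3" using xm[OF x] by (intro power_mono) auto
    have h3: "h^3 \<le> h^2" "h^4 \<le> h^2" using h by (auto intro: power_decreasing)
    have "\<bar>(x-m)\<^sup>2 - h\<^sup>2/12\<bar> \<le> h^2"
      using sq zero_le_power2[of "x-m"] zero_le_power2[of h] by linarith
    then have "\<bar>d2/2*((x-m)\<^sup>2 - h\<^sup>2/12)\<bar> \<le> M/2 * h^2"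
      using M unfolding abs_mult by (intro mult_mono) auto
    moreover have "\<bar>h\<^sup>2/4*(x-m)\<bar> \<le> h^2/4*(h/2)"
      using xm[OF x] unfolding abs_mult by (intro mult_mono) auto
    then have "\<bar>(x-m)^3 + h\<^sup>2/4*(x-m)\<bar> \<le> h^3"
    proof -
      have "\<bar>(x-m)^3\<bar> \<le> h^3/8" "h^2/4*(h/2) = h^3/8"
        using cu by (simp add: power_abs power_divide, simp add: eval_nat_numeral)
      moreover have "h^3 \<ge> 0" using h by simp
      ultimately show ?thesis
        using \<open>\<bar>h\<^sup>2/4*(x-m)\<bar> \<le> h^2/4*(h/2)\<close> abs_triangle_ineq[of "(x-m)^3" "h\<^sup>2/4*(x-m)"]
        by linarith
    qed
    then have "\<bar>d3/6*((x-m)^3 + h\<^sup>2/4*(x-m))\<bar> \<le> M/6 * h^3"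
      using M unfolding abs_mult by (intro mult_mono) auto
    moreover have "M/6 * h^3 \<le> M/6*h^2" "M * h^4 \<le> M * h^2"
      using h3 M0 by (auto intro!: mult_left_mono)
    moreover have "0 \<le> M * h^2" using M0 by simp
    ultimately show ?thesis using \<rho>[OF x] unfolding p_def by linarith
  qed
  have P0: "integral ?I (p m h) = 0"
  proof -
    have "(p m h has_integral 0) ?I"
    proof -
      have "p m h = (\<lambda>x. -d2*h^2/24 + d3*h^2/24*(x-m) + d2/2*(x-m)^2 + d3/6*(x-m)^3 + 0*(x-m)^4)"
        by (rule ext) (simp add: p_def field_simps)
      moreover have "2*(-d2*h^2/24)*(h/2) + 2/3*(d2/2)*(h/2)^3 + 2/5*0*(h/2)^5 = 0"
        by (simp add: eval_nat_numeral)
      ultimately show ?thesis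
        using has_integral_centered_poly[of "h/2" "-d2*h^2/24" "d3*h^2/24" m "d2/2" "d3/6" 0] h
        by (simp only: half_gt_zero less_imp_le)
    qed
    then show ?thesis by (rule integral_unique)
  qed
  have P1: "integral ?I (\<lambda>x. (x-m) * p m h x) = h^5 * d3 / 180"
  proof -
    have "((\<lambda>x. (x-m) * p m h x) has_integral h^5 * d3 / 180) ?I"
    proof -
      have "(\<lambda>x. (x-m) * p m h x) =
          (\<lambda>x. 0 + (-d2*h^2/24)*(x-m) + d3*h^2/24*(x-m)^2 + d2/2*(x-m)^3 + d3/6*(x-m)^4)"
        by (rule ext) (simp add: p_def field_simps eval_nat_numeral)
      moreover have "2*0*(h/2) + 2/3*(d3*h^2/24)*(h/2)^3 + 2/5*(d3/6)*(h/2)^5 = h^5 * d3 / 180"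
        by (simp add: eval_nat_numeral)
      ultimately show ?thesis
        using has_integral_centered_poly[of "h/2" 0 "-d2*h^2/24" m "d3*h^2/24" "d2/2" "d3/6"] h
        by (simp only: half_gt_zero less_imp_le)
    qed
    then show ?thesis by (rule integral_unique)
  qed
  have "integral ?I \<rho> = integral ?I (\<lambda>x. \<rho> x - p m h x) + integral ?I (p m h)"
    using integral_diff[OF integrable_continuous_interval[OF cont] integrable_continuous_interval[OF pc]]
    by simp
  moreover have "norm (integral ?I (\<lambda>x. \<rho> x - p m h x)) \<le> M * h^4 * ((m + h/2) - (m - h/2))"
    using h \<rho> by (intro integral_bound continuous_on_diff cont pc) auto
  ultimately show "\<bar>integral ?I \<rho>\<bar> \<le> M * h^5"
    using P0 by (simp add: eval_nat_numeral mult.assoc)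
  have "continuous_on ?I (\<lambda>x. (x-m) * \<rho> x)" "continuous_on ?I (\<lambda>x. (x-m) * p m h x)"
    by (intro continuous_intros cont pc)+
  then have "integral ?I (\<lambda>x. (x-m) * \<rho> x) - integral ?I (\<lambda>x. (x-m) * p m h x)
      = integral ?I (\<lambda>x. (x-m) * \<rho> x - (x-m) * p m h x)"
    by (intro integral_diff[symmetric] integrable_continuous_interval)
  also have "norm \<dots> \<le> h * (M * h^4) * ((m + h/2) - (m - h/2))"
  proof (intro integral_bound)
    show "continuous_on ?I (\<lambda>x. (x-m) * \<rho> x - (x-m) * p m h x)"
      by (intro continuous_intros cont pc)
    fix x assume x: "x \<in> ?I"
    have "norm ((x-m) * \<rho> x - (x-m) * p m h x) = \<bar>x-m\<bar> * \<bar>\<rho> x - p m h x\<bar>"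
      by (simp add: abs_mult flip: right_diff_distrib)
    also have "\<dots> \<le> h * (M * h^4)" using xm[OF x] h \<rho>[OF x] by (intro mult_mono) auto
    finally show "norm ((x-m) * \<rho> x - (x-m) * p m h x) \<le> h * (M * h^4)" .
  qed (use h in auto)
  finally show "\<bar>integral ?I (\<lambda>x. (x-m) * \<rho> x) - h^5 * d3 / 180\<bar> \<le> M * h^6"
    unfolding P1 by (simp add: eval_nat_numeral algebra_simps)
qed

text \<open>
  Expanding \<open>u\<close> about \<open>m\<close> to first order reduces the integral to the two moments of \<open>\<rho>\<close>; the
  remainder of \<open>u\<close> and \<open>\<rho>\<close> itself are both \<open>O(h\<^sup>2)\<close> on an interval of length \<open>h\<close>.
\<close>
lemma defect_weighted_integral:
  fixes u u1 u2 \<rho> :: "real \<Rightarrow> real"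
  defines "I \<equiv> \<lambda>m h. {m - h/2..m + h/2 :: real}"
  assumes h: "0 < h" "h \<le> 1" and M: "\<bar>d3\<bar> \<le> M"
    and cont: "continuous_on (I m h) \<rho>"
    and \<rho>: "\<And>x. x \<in> I m h \<Longrightarrow> \<bar>\<rho> x\<bar> \<le> 2 * M * h\<^sup>2"
      "\<bar>integral (I m h) \<rho>\<bar> \<le> M * h^5"
      "\<bar>integral (I m h) (\<lambda>x. (x-m) * \<rho> x) - h^5 * d3 / 180\<bar> \<le> M * h^6"
    and d: "\<And>x. x \<in> I m h \<Longrightarrow> (u has_real_derivative u1 x) (at x within I m h)"
      "\<And>x. x \<in> I m h \<Longrightarrow> (u1 has_real_derivative u2 x) (at x within I m h)"
    and U: "\<bar>u m\<bar> \<le> U" "\<bar>u1 m\<bar> \<le> U" "\<And>x. x \<in> I m h \<Longrightarrow> \<bar>u2 x\<bar> \<le> U"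
  shows "\<bar>integral (I m h) (\<lambda>x. u x * \<rho> x)\<bar> \<le> 5 * U * M * h^5"
proof -
  have M0: "M \<ge> 0" and U0: "U \<ge> 0" using M U by linarith+
  have mI: "m \<in> {m - h/2..m + h/2}" using h by auto
  note d' = d[unfolded I_def]
  have uc: "continuous_on (I m h) u"
    using d(1) by (meson DERIV_continuous_on)
  define r1 where "r1 = (\<lambda>x. u1 x - u1 m)"
  define r where "r = (\<lambda>x. u x - u m - u1 m * (x-m))"
  have b1: "\<bar>r1 x\<bar> \<le> U * \<bar>x-m\<bar>^1" if "x \<in> I m h" for x
    using increment_bound_power[OF d'(2) mI, of U 0 x] U U0 that by (simp add: I_def r1_def)
  have b0: "\<bar>r x\<bar> \<le> U * \<bar>x-m\<bar>^2" if "x \<in> I m h" for x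
  proof -
    have "(r has_real_derivative r1 x) (at x within {m-h/2..m+h/2})"
      if "x \<in> {m-h/2..m+h/2}" for x
      unfolding r_def r1_def by (rule derivative_eq_intros d'(1)[OF that] refl | simp)+
    from increment_bound_power[OF this mI, of U 1 x] b1 U0 that show ?thesis
      by (simp add: I_def r_def eval_nat_numeral)
  qed
  have rb: "\<bar>r x\<bar> \<le> U * h^2" if "x \<in> I m h" for x
  proof -
    have "\<bar>x-m\<bar> \<le> h" using that h unfolding I_def atLeastAtMost_iff by linarith
    then have "U * \<bar>x-m\<bar>^2 \<le> U * h^2" using U0 by (intro mult_left_mono power_mono) auto
    then show ?thesis using b0[OF that] by linarith
  qed
  have rc: "continuous_on (I m h) r" unfolding r_def by (intro continuous_intros uc)
  have ints: "\<rho> integrable_on I m h" "(\<lambda>x. (x-m) * \<rho> x) integrable_on I m h"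
      "(\<lambda>x. r x * \<rho> x) integrable_on I m h"
    unfolding I_def by (intro integrable_continuous_interval continuous_intros cont[unfolded I_def] rc[unfolded I_def])+
  have "((\<lambda>x. u m * \<rho> x + u1 m * ((x-m) * \<rho> x) + r x * \<rho> x) has_integral
     (u m * integral (I m h) \<rho> + u1 m * integral (I m h) (\<lambda>x. (x-m) * \<rho> x)
       + integral (I m h) (\<lambda>x. r x * \<rho> x))) (I m h)"
    by (intro has_integral_add has_integral_mult_right integrable_integral ints)
  moreover have "(\<lambda>x. u m * \<rho> x + u1 m * ((x-m) * \<rho> x) + r x * \<rho> x) = (\<lambda>x. u x * \<rho> x)"
    by (simp add: r_def algebra_simps)
  ultimately have eq: "integral (I m h) (\<lambda>x. u x * \<rho> x) =
     u m * integral (I m h) \<rho> + u1 m * integral (I m h) (\<lambda>x. (x-m) * \<rho> x)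
       + integral (I m h) (\<lambda>x. r x * \<rho> x)"
    by (simp add: integral_unique)
  have hp: "h^6 \<le> h^5" using h by (auto intro: power_decreasing)
  have "\<bar>u m * integral (I m h) \<rho>\<bar> \<le> U * (M * h^5)"
    unfolding abs_mult using U \<rho>(2) by (intro mult_mono) auto
  moreover have "\<bar>u1 m * integral (I m h) (\<lambda>x. (x-m) * \<rho> x)\<bar> \<le> U * (2 * (M * h^5))"
  proof -
    have "\<bar>h^5 * d3\<bar> \<le> h^5 * M" using M h by (simp add: abs_mult)
    moreover have "M * h^6 \<le> M * h^5" using hp M0 by (intro mult_left_mono) auto
    ultimately have "\<bar>integral (I m h) (\<lambda>x. (x-m) * \<rho> x)\<bar> \<le> 2 * (M * h^5)"
      using \<rho>(3) by (simp add: mult.commute)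
    then show ?thesis unfolding abs_mult using U U0 by (intro mult_mono) auto
  qed
  moreover have "norm (integral (I m h) (\<lambda>x. r x * \<rho> x)) \<le> (U*h^2)*(2*M*h^2) * ((m+h/2) - (m-h/2))"
    unfolding I_def
  proof (intro integral_bound)
    show "continuous_on {m-h/2..m+h/2} (\<lambda>x. r x * \<rho> x)"
      using rc cont unfolding I_def by (intro continuous_intros)
    fix x assume "x \<in> {m-h/2..m+h/2}"
    then have "x \<in> I m h" by (simp add: I_def)
    then show "norm (r x * \<rho> x) \<le> (U*h^2)*(2*M*h^2)"
      using rb \<rho>(1) U0 unfolding real_norm_def abs_mult by (intro mult_mono) auto
  qed (use h in auto)
  then have "\<bar>integral (I m h) (\<lambda>x. r x * \<rho> x)\<bar> \<le> 2 * (U * (M * h^5))"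
    by (simp add: eval_nat_numeral algebra_simps)
  ultimately show ?thesis unfolding eq by (simp add: mult.assoc)
qed

section \<open>The inner product in terms of means and slopes\<close>

lemma has_integral_elems:
  fixes f :: "real \<Rightarrow> real"
  assumes N: "N > 0" and "\<And>j. j < N \<Longrightarrow> (f has_integral I j) (elem N j)"
  shows "(f has_integral (\<Sum>j<N. I j)) {0..1}"
proof -
  have "(f has_integral (\<Sum>j<n. I j)) {0..node N n}" if "n \<le> N" for n
    using that
  proof (induction n)
    case (Suc n)
    show ?case
      using has_integral_combine[of 0 "node N n" "node N (Suc n)" f "\<Sum>j<n. I j" "I n"]
        node_mono[of 0 n N] node_less[OF N, of n] Suc assms(2)[of n]
      by simp
  qed (simp add: has_integral_refl)
  from this[of N] N show ?thesis by simp
qed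

lemma absolutely_integrable_elems:
  fixes f :: "real \<Rightarrow> real"
  assumes N: "N > 0" and "\<And>j. j < N \<Longrightarrow> f absolutely_integrable_on (elem N j)"
  shows "f absolutely_integrable_on {0..1}"
proof -
  have "f absolutely_integrable_on {0..node N n}" if "n \<le> N" for n
    using that
  proof (induction n)
    case 0
    then show ?case
      using absolutely_integrable_continuous_real[of 0 0 f] by simp
  next
    case (Suc n)
    have "{0..node N (Suc n)} = {0..node N n} \<union> elem N n"
      using node_mono[of 0 n N] node_less[OF N, of n] by auto
    then show ?case
      using Suc assms(2)[of n] by (auto intro!: set_integrable_Un)
  qed
  from this[of N] N show ?thesis by simp
qed

text \<open>
  The factor \<open>f\<close> may be arbitrary at the nodes. This admits the derivative of \<open>u \<eta>\<^sub>h\<close>, which is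
  given by a different continuous function on each element.
\<close>
lemma L2_inner_elems:
  assumes N: "N > 0" and G: "\<And>j. j < N \<Longrightarrow> continuous_on (elem N j) (G j)"
    and eq: "\<And>j x. j < N \<Longrightarrow> x \<in> {node N j<..<node N (Suc j)} \<Longrightarrow> f x * g x = G j x"
  shows "L2_inner f g = (\<Sum>j<N. integral (elem N j) (G j))"
proof -
  let ?F = "\<lambda>x. f x * g x"
  have neg: "negligible {node N j, node N (Suc j)}" for j by simp
  have spike: "?F x = G j x" if "j < N" "x \<in> elem N j - {node N j, node N (Suc j)}" for j x
    using that eq[of j x] by auto
  have "(?F has_integral integral (elem N j) (G j)) (elem N j)" if "j < N" for j
    using has_integral_spike[OF neg[of j], of "elem N j" ?F "G j"] spike[OF that]
      integrable_integral[OF integrable_continuous_interval[OF G[OF that]]] by blast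
  then have F1: "(?F has_integral (\<Sum>j<N. integral (elem N j) (G j))) {0..1}"
    by (rule has_integral_elems[OF N])
  have "?F absolutely_integrable_on (elem N j)" if "j < N" for j
    by (rule absolutely_integrable_spike[OF absolutely_integrable_continuous_real[OF G[OF that]] neg[of j]])
      (rule spike[OF that])
  then have "?F absolutely_integrable_on {0..1}"
    by (rule absolutely_integrable_elems[OF N])
  then have "?F absolutely_integrable_on {0<..<1}"
    by (rule set_integrable_subset) auto
  then have "integrable (lebesgue_on {0<..<1}) ?F"
    by (simp add: integrable_restrict_space set_integrable_def)
  then have "L2_inner f g = integral {0<..<1} ?F"
    unfolding L2_inner_def by (rule lebesgue_integral_eq_integral) auto
  also have "\<dots> = integral {0..1} ?F"
    by (simp add: integral_open_interval_real)
  finally show ?thesis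
    using integral_unique[OF F1] by simp
qed

lemma continuous_on_elem:
  "N > 0 \<Longrightarrow> j < N \<Longrightarrow> continuous_on {0..1} f \<Longrightarrow> continuous_on (elem N j) f"
  using continuous_on_subset elem_subset by blast

lemma L2_inner_eq_integral:
  assumes "continuous_on {0..1} f" "continuous_on {0..1} g"
  shows "L2_inner f g = integral {0..1} (\<lambda>x. f x * g x)"
proof -
  have e: "elem 1 0 = {0..1}" by (simp add: node_def)
  have "L2_inner f g = (\<Sum>j<1. integral (elem 1 j) (\<lambda>x. f x * g x))"
  proof (rule L2_inner_elems)
    show "continuous_on (elem 1 j) (\<lambda>x. f x * g x)" if "j < 1" for j
    proof -
      have "j = 0" using that by simp
      then show ?thesis using e assms by (auto intro!: continuous_intros)
    qed
  qed auto
  then show ?thesis using e by simp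
qed

lemma L2_inner_commute: "L2_inner f g = L2_inner g f"
  by (simp add: L2_inner_def mult.commute)

lemma L2_inner_cong:
  assumes "\<And>x. x \<in> {0..1} \<Longrightarrow> f x = f' x"
  shows "L2_inner f g = L2_inner f' g"
  unfolding L2_inner_def by (rule Bochner_Integration.integral_cong) (use assms in auto)

lemma L2_inner_lincomb_left:
  assumes "continuous_on {0..1} f" "continuous_on {0..1} g" "continuous_on {0..1} k"
  shows "L2_inner (\<lambda>x. a * f x + b * g x) k = a * L2_inner f k + b * L2_inner g k"
proof -
  have i: "(\<lambda>x. f x * k x) integrable_on {0..1}" "(\<lambda>x. g x * k x) integrable_on {0..1}"
    using assms by (auto intro!: integrable_continuous_interval continuous_intros)
  have "((\<lambda>x. a * (f x * k x) + b * (g x * k x)) has_integral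
      (a * integral {0..1} (\<lambda>x. f x * k x) + b * integral {0..1} (\<lambda>x. g x * k x))) {0..1}"
    by (intro has_integral_add has_integral_mult_right integrable_integral i)
  then have "integral {0..1} (\<lambda>x. (a * f x + b * g x) * k x) =
      a * integral {0..1} (\<lambda>x. f x * k x) + b * integral {0..1} (\<lambda>x. g x * k x)"
    by (intro integral_unique) (simp add: algebra_simps)
  moreover have "continuous_on {0..1} (\<lambda>x. a * f x + b * g x)"
    using assms by (intro continuous_intros)
  ultimately show ?thesis using assms by (simp add: L2_inner_eq_integral)
qed

lemma L2_inner_diff_left:
  assumes "continuous_on {0..1} f" "continuous_on {0..1} g" "continuous_on {0..1} k"
  shows "L2_inner (\<lambda>x. f x - g x) k = L2_inner f k - L2_inner g k"
  using L2_inner_lincomb_left[OF assms, of 1 "-1"] by simp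

lemma L2_inner_scale_left:
  assumes "continuous_on {0..1} f" "continuous_on {0..1} k"
  shows "L2_inner (\<lambda>x. a * f x) k = a * L2_inner f k"
  using L2_inner_lincomb_left[OF assms(1) assms, of a 0] by simp

lemma L2_inner_sum_left:
  assumes "finite A" "\<And>i. i \<in> A \<Longrightarrow> continuous_on {0..1} (f i)" "continuous_on {0..1} k"
  shows "L2_inner (\<lambda>x. \<Sum>i\<in>A. c i * f i x) k = (\<Sum>i\<in>A. c i * L2_inner (f i) k)"
  using assms(1,2)
proof (induction A rule: finite_induct)
  case empty
  then show ?case by (simp add: L2_inner_def)
next
  case (insert i A)
  have "continuous_on {0..1} (\<lambda>x. \<Sum>i\<in>A. c i * f i x)"
    using insert by (intro continuous_intros) auto
  then show ?case
    using insert L2_inner_lincomb_left[of "f i" "\<lambda>x. \<Sum>i\<in>A. c i * f i x" k "c i" 1] assms(3) by simp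
qed

lemma L2_inner_continuous_Sh2:
  assumes N: "N > 0" and f: "continuous_on {0..1} f" and \<phi>: "\<phi> \<in> Sh2 N"
  shows "L2_inner f \<phi> = (\<Sum>j<N. mean N \<phi> j * integral (elem N j) f
            + slope N \<phi> j * integral (elem N j) (\<lambda>x. (x - midpt N j) * f x))"
proof -
  let ?G = "\<lambda>j x. mean N \<phi> j * f x + slope N \<phi> j * ((x - midpt N j) * f x)"
  have fc: "continuous_on (elem N j) f" if "j < N" for j
    using continuous_on_elem[OF N that f] .
  have "L2_inner f \<phi> = (\<Sum>j<N. integral (elem N j) (?G j))"
  proof (rule L2_inner_elems[OF N])
    show "continuous_on (elem N j) (?G j)" if "j < N" for j
      by (intro continuous_intros fc that)
    show "f x * \<phi> x = ?G j x" if "j < N" "x \<in> {node N j<..<node N (Suc j)}" for j x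
    proof -
      have "\<phi> x = mean N \<phi> j + slope N \<phi> j * (x - midpt N j)"
        using Sh2_on_elem[OF N \<phi> that(1), of x] that(2) by simp
      then show ?thesis by (simp only:) (simp add: algebra_simps)
    qed
  qed
  also have "\<dots> = (\<Sum>j<N. mean N \<phi> j * integral (elem N j) f
            + slope N \<phi> j * integral (elem N j) (\<lambda>x. (x - midpt N j) * f x))"
  proof (intro sum.cong refl integral_unique has_integral_add has_integral_mult_right integrable_integral)
    fix j assume "j \<in> {..<N}"
    then have "j < N" by simp
    show "f integrable_on elem N j" "(\<lambda>x. (x - midpt N j) * f x) integrable_on elem N j"
      by (intro integrable_continuous_interval continuous_intros fc \<open>j < N\<close>)+
  qed
  finally show ?thesis .
qed

text \<open>
  On each element \<open>1\<close> and \<open>x - midpt N j\<close> are orthogonal, so the means and slopes diagonalise the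
  inner product. All estimates below are made element by element in these coordinates.
\<close>
lemma L2_inner_Sh2:
  assumes N: "N > 0" and \<phi>: "\<phi> \<in> Sh2 N" and \<psi>: "\<psi> \<in> Sh2 N"
  shows "L2_inner \<phi> \<psi> = (\<Sum>j<N. (1 / real N) * (mean N \<phi> j * mean N \<psi> j)
            + (1 / real N)^3 / 12 * (slope N \<phi> j * slope N \<psi> j))"
proof -
  define h where "h = 1 / real N"
  let ?G = "\<lambda>j x. mean N \<phi> j * mean N \<psi> j
      + (mean N \<phi> j * slope N \<psi> j + slope N \<phi> j * mean N \<psi> j) * (x - midpt N j)
      + slope N \<phi> j * slope N \<psi> j * (x - midpt N j)^2 + 0 * (x - midpt N j)^3 + 0 * (x - midpt N j)^4"
  have "L2_inner \<phi> \<psi> = (\<Sum>j<N. integral (elem N j) (?G j))"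
  proof (rule L2_inner_elems[OF N])
    show "continuous_on (elem N j) (?G j)" if "j < N" for j
      by (intro continuous_intros)
    show "\<phi> x * \<psi> x = ?G j x" if "j < N" "x \<in> {node N j<..<node N (Suc j)}" for j x
    proof -
      have "\<phi> x = mean N \<phi> j + slope N \<phi> j * (x - midpt N j)"
          "\<psi> x = mean N \<psi> j + slope N \<psi> j * (x - midpt N j)"
        using Sh2_on_elem[OF N \<phi> that(1), of x] Sh2_on_elem[OF N \<psi> that(1), of x] that(2) by auto
      then show ?thesis by (simp only:) (simp add: algebra_simps power2_eq_square)
    qed
  qed
  also have "\<dots> = (\<Sum>j<N. h * (mean N \<phi> j * mean N \<psi> j) + h^3 / 12 * (slope N \<phi> j * slope N \<psi> j))"
  proof (intro sum.cong refl)
    fix j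
    have "h \<ge> 0" by (simp add: h_def)
    then have "h / 2 \<ge> 0" by simp
    have "integral (elem N j) (?G j) = 2 * (mean N \<phi> j * mean N \<psi> j) * (h/2)
        + 2/3 * (slope N \<phi> j * slope N \<psi> j) * (h/2)^3 + 2/5 * 0 * (h/2)^5"
      unfolding elem_eq[OF N] h_def[symmetric]
      by (rule integral_unique[OF has_integral_centered_poly[OF \<open>h / 2 \<ge> 0\<close>]])
    also have "\<dots> = h * (mean N \<phi> j * mean N \<psi> j) + h^3 / 12 * (slope N \<phi> j * slope N \<psi> j)"
      by (simp add: power_divide)
    finally show "integral (elem N j) (?G j)
      = h * (mean N \<phi> j * mean N \<psi> j) + h^3 / 12 * (slope N \<phi> j * slope N \<psi> j)" .
  qed
  finally show ?thesis unfolding h_def .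
qed

text \<open>
  The inverse inequality \<open>\<parallel>\<phi>\<parallel>\<^sub>\<infinity> \<le> C h\<^sup>-\<^sup>1\<^sup>/\<^sup>2 \<parallel>\<phi>\<parallel>\<close>, squared: the element that contains \<open>x\<close>
  already controls the value at \<open>x\<close>.
\<close>
lemma Sh2_sup_bound:
  assumes N: "N > 0" and \<phi>: "\<phi> \<in> Sh2 N" and x: "x \<in> {0..1}"
  shows "(\<phi> x)\<^sup>2 \<le> 6 * real N * L2_inner \<phi> \<phi>"
proof -
  define h where "h = 1 / real N"
  have h: "h > 0" "real N = 1 / h" using N by (simp_all add: h_def)
  obtain j where j: "j < N" "x \<in> elem N j" using elem_cover[OF N x] by blast
  let ?c = "mean N \<phi> j" and ?s = "slope N \<phi> j" and ?d = "x - midpt N j"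
  have "\<bar>?d\<bar> \<le> h / 2" using midpt_dist[OF N j(2)] by (simp add: h_def)
  then have "\<bar>?d\<bar>\<^sup>2 \<le> (h/2)\<^sup>2" by (intro power_mono) auto
  then have d: "?d\<^sup>2 \<le> h\<^sup>2 / 4" by (simp add: power_divide)
  have "(\<phi> x)\<^sup>2 = (?c + ?s * ?d)\<^sup>2" using Sh2_on_elem[OF N \<phi> j] by simp
  also have "\<dots> \<le> 2 * ?c\<^sup>2 + 2 * (?s * ?d)\<^sup>2"
    using zero_le_power2[of "?c - ?s * ?d"] by (simp add: power2_sum power2_diff)
  also have "(?s * ?d)\<^sup>2 \<le> ?s\<^sup>2 * (h\<^sup>2 / 4)"
    unfolding power_mult_distrib by (intro mult_left_mono d) auto
  finally have 1: "(\<phi> x)\<^sup>2 \<le> 2 * ?c\<^sup>2 + ?s\<^sup>2 * h\<^sup>2 / 2" by (simp add: mult.commute)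
  have "2 * ?c\<^sup>2 + ?s\<^sup>2 * h\<^sup>2 / 2 \<le> 6 / h * (h * (?c * ?c) + h^3 / 12 * (?s * ?s))"
    using h by (simp add: field_simps eval_nat_numeral)
  also have "\<dots> \<le> 6 / h * L2_inner \<phi> \<phi>"
  proof (intro mult_left_mono)
    show "h * (?c * ?c) + h^3 / 12 * (?s * ?s) \<le> L2_inner \<phi> \<phi>"
      unfolding L2_inner_Sh2[OF N \<phi> \<phi>] h_def[symmetric]
      by (rule member_le_sum[of j "{..<N}" "\<lambda>j. h * (mean N \<phi> j * mean N \<phi> j) + h^3 / 12 * (slope N \<phi> j * slope N \<phi> j)"])
         (use j h in auto)
  qed (use h in auto)
  finally show ?thesis using 1 h by simp
qed

section \<open>Integration by parts\<close>

lemma Sh2_DERIV: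
  assumes N: "N > 0" and \<phi>: "\<phi> \<in> Sh2 N" and j: "j < N" and x: "x \<in> {node N j<..<node N (Suc j)}"
  shows "(\<phi> has_real_derivative slope N \<phi> j) (at x)"
proof -
  have "((\<lambda>x. mean N \<phi> j + slope N \<phi> j * (x - midpt N j)) has_real_derivative slope N \<phi> j) (at x)"
    by (auto intro!: derivative_eq_intros)
  then show ?thesis
    by (rule has_field_derivative_transform_within_open[OF _ open_greaterThanLessThan x])
       (use Sh2_on_elem[OF N \<phi> j] in auto)
qed

text \<open>
  Integration by parts against a test function with piecewise constant derivative. The boundary
  terms of neighbouring elements cancel because \<open>g\<close> and \<open>\<phi>\<close> are continuous, and those at 0 and 1
  vanish with \<open>g\<close>.
\<close>
lemma sum_integral_by_parts:
  assumes N: "N > 0" and \<phi>: "\<phi> \<in> Sh2 N" and g: "continuous_on {0..1} g" "g 0 = 0" "g 1 = 0"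
    and G: "\<And>j. j < N \<Longrightarrow> continuous_on (elem N j) (G j)"
    and d: "\<And>j x. j < N \<Longrightarrow> x \<in> {node N j<..<node N (Suc j)} \<Longrightarrow> (g has_real_derivative G j x) (at x)"
  shows "(\<Sum>j<N. integral (elem N j) (\<lambda>x. G j x * \<phi> x)) = - (\<Sum>j<N. slope N \<phi> j * integral (elem N j) g)"
proof -
  have el: "integral (elem N j) (\<lambda>x. G j x * \<phi> x) =
     (g (node N (Suc j)) * \<phi> (node N (Suc j)) - g (node N j) * \<phi> (node N j)) - slope N \<phi> j * integral (elem N j) g"
    if j: "j < N" for j
  proof -
    have gc: "continuous_on (elem N j) g" and pc: "continuous_on (elem N j) \<phi>"
      using continuous_on_elem[OF N j] g(1) Sh2_continuous[OF \<phi>] by auto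
    have "((\<lambda>x. G j x * \<phi> x + g x * slope N \<phi> j) has_integral
      (g (node N (Suc j)) * \<phi> (node N (Suc j)) - g (node N j) * \<phi> (node N j))) (elem N j)"
    proof (rule fundamental_theorem_of_calculus_interior)
      show "node N j \<le> node N (Suc j)" using node_less[OF N, of j] by simp
      show "continuous_on (elem N j) (\<lambda>x. g x * \<phi> x)" by (intro continuous_intros gc pc)
      fix x assume x: "x \<in> {node N j<..<node N (Suc j)}"
      from DERIV_mult[OF d[OF j x] Sh2_DERIV[OF N \<phi> j x]]
      show "((\<lambda>x. g x * \<phi> x) has_vector_derivative G j x * \<phi> x + g x * slope N \<phi> j) (at x)"
        by (simp add: has_real_derivative_iff_has_vector_derivative mult.commute add.commute)
    qed
    moreover have "((\<lambda>x. g x * slope N \<phi> j) has_integral integral (elem N j) g * slope N \<phi> j) (elem N j)"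
      by (intro has_integral_mult_left integrable_integral integrable_continuous_interval gc)
    ultimately have "((\<lambda>x. G j x * \<phi> x + g x * slope N \<phi> j - g x * slope N \<phi> j) has_integral
      (g (node N (Suc j)) * \<phi> (node N (Suc j)) - g (node N j) * \<phi> (node N j)) - integral (elem N j) g * slope N \<phi> j) (elem N j)"
      by (rule has_integral_diff)
    then show ?thesis by (simp add: integral_unique mult.commute)
  qed
  have "(\<Sum>j<N. g (node N (Suc j)) * \<phi> (node N (Suc j)) - g (node N j) * \<phi> (node N j)) = 0"
    using sum_lessThan_telescope[of "\<lambda>j. g (node N j) * \<phi> (node N j)" N] g N by simp
  then show ?thesis by (simp add: el sum_subtractf)
qed

lemma L2_inner_flux_continuous:
  assumes N: "N > 0" and u: "u \<in> Ck_space 1" "u 0 = 0" "u 1 = 0" and f: "f \<in> Ck_space 1" and \<phi>: "\<phi> \<in> Sh2 N"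
  shows "L2_inner (\<lambda>x. deriv01 u x * f x + u x * deriv01 f x) \<phi>
      = - (\<Sum>j<N. slope N \<phi> j * integral (elem N j) (\<lambda>x. u x * f x))"
proof -
  let ?G = "\<lambda>x. deriv01 u x * f x + u x * deriv01 f x"
  have c: "continuous_on {0..1} u" "continuous_on {0..1} (deriv01 u)"
    "continuous_on {0..1} f" "continuous_on {0..1} (deriv01 f)"
    using Ck_space_continuous[OF u(1), of 0] Ck_space_continuous[OF u(1), of 1]
      Ck_space_continuous[OF f, of 0] Ck_space_continuous[OF f, of 1] by simp_all
  have G: "continuous_on {0..1} ?G" using c by (intro continuous_intros)
  have "L2_inner ?G \<phi> = (\<Sum>j<N. integral (elem N j) (\<lambda>x. ?G x * \<phi> x))"
    using continuous_on_elem[OF N _ G] continuous_on_elem[OF N _ Sh2_continuous[OF \<phi>]]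
    by (intro L2_inner_elems[OF N] continuous_on_mult) auto
  also have "\<dots> = - (\<Sum>j<N. slope N \<phi> j * integral (elem N j) (\<lambda>x. u x * f x))"
  proof (rule sum_integral_by_parts[OF N \<phi>])
    show "continuous_on {0..1} (\<lambda>x. u x * f x)" using c by (intro continuous_intros)
    fix j assume j: "j < N"
    show "continuous_on (elem N j) ?G" by (rule continuous_on_elem[OF N j G])
    fix x assume x: "x \<in> {node N j<..<node N (Suc j)}"
    have x01: "x \<in> {0<..<1}" using x node_mono[of 0 j N] node_mono[of "Suc j" N N] j N by auto
    have "(u has_real_derivative deriv01 u x) (at x)" "(f has_real_derivative deriv01 f x) (at x)"
      using Ck_space_derivative[OF u(1), of 0 x] Ck_space_derivative[OF f, of 0 x] x01
        at_within_interior[of x "{0..1}"] by simp_all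
    then show "((\<lambda>x. u x * f x) has_real_derivative ?G x) (at x)"
      by (auto intro!: derivative_eq_intros)
  qed (use u in auto)
  finally show ?thesis .
qed

text \<open>
  Here the argument of \<open>deriv\<close> has kinks at the nodes, where \<open>deriv\<close> has no meaningful value;
  inside the elements it is the classical derivative.
\<close>
lemma L2_inner_flux_Sh2:
  assumes N: "N > 0" and u: "u \<in> Ck_space 1" "u 0 = 0" "u 1 = 0" and \<psi>: "\<psi> \<in> Sh2 N" and \<phi>: "\<phi> \<in> Sh2 N"
  shows "L2_inner (deriv (\<lambda>y. u y * \<psi> y)) \<phi>
      = - (\<Sum>j<N. slope N \<phi> j * integral (elem N j) (\<lambda>x. u x * \<psi> x))"
proof -
  let ?G = "\<lambda>j x. deriv01 u x * \<psi> x + u x * slope N \<psi> j"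
  have c: "continuous_on {0..1} u" "continuous_on {0..1} (deriv01 u)"
    using Ck_space_continuous[OF u(1), of 0] Ck_space_continuous[OF u(1), of 1] by simp_all
  have G: "continuous_on (elem N j) (?G j)" if "j < N" for j
    using continuous_on_elem[OF N that] c Sh2_continuous[OF \<psi>] by (intro continuous_intros) auto
  have D: "((\<lambda>x. u x * \<psi> x) has_real_derivative ?G j x) (at x)"
    if j: "j < N" and x: "x \<in> {node N j<..<node N (Suc j)}" for j x
  proof -
    have x01: "x \<in> {0<..<1}" using x node_mono[of 0 j N] node_mono[of "Suc j" N N] j N by auto
    have "(u has_real_derivative deriv01 u x) (at x)"
      using Ck_space_derivative[OF u(1), of 0 x] x01 at_within_interior[of x "{0..1}"] by simp
    then show ?thesis using Sh2_DERIV[OF N \<psi> j x] by (auto intro!: derivative_eq_intros)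
  qed
  have "L2_inner (deriv (\<lambda>y. u y * \<psi> y)) \<phi> = (\<Sum>j<N. integral (elem N j) (\<lambda>x. ?G j x * \<phi> x))"
  proof (rule L2_inner_elems[OF N])
    show "continuous_on (elem N j) (\<lambda>x. ?G j x * \<phi> x)" if "j < N" for j
      by (rule continuous_on_mult[OF G[OF that] continuous_on_elem[OF N that Sh2_continuous[OF \<phi>]]])
    show "deriv (\<lambda>y. u y * \<psi> y) x * \<phi> x = ?G j x * \<phi> x"
      if "j < N" "x \<in> {node N j<..<node N (Suc j)}" for j x
      using DERIV_imp_deriv[OF D[OF that]] by simp
  qed
  also have "\<dots> = - (\<Sum>j<N. slope N \<phi> j * integral (elem N j) (\<lambda>x. u x * \<psi> x))"
    using c Sh2_continuous[OF \<psi>] u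
    by (intro sum_integral_by_parts[OF N \<phi> _ _ _ G D] continuous_intros) auto
  finally show ?thesis .
qed

section \<open>Orthonormal bases and projection\<close>

lemma L2_inner_orthonormal_sum:
  assumes "\<And>k. k < m \<Longrightarrow> continuous_on {0..1} (q k)"
    and "\<And>k l. k < m \<Longrightarrow> l < m \<Longrightarrow> L2_inner (q k) (q l) = (if k = l then 1 else 0)"
    and "l < (m::nat)"
  shows "L2_inner (\<lambda>x. \<Sum>k<m. c k * q k x) (q l) = c l"
proof -
  have "L2_inner (\<lambda>x. \<Sum>k<m. c k * q k x) (q l) = (\<Sum>k<m. c k * L2_inner (q k) (q l))"
    using assms by (intro L2_inner_sum_left) auto
  also have "\<dots> = (\<Sum>k<m. if k = l then c k else 0)"
    using assms(2,3) by (intro sum.cong) auto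
  finally show ?thesis using assms(3) by simp
qed

text \<open>
  The last clause expresses the spanning property by the Fourier expansion.
\<close>
definition orthonormal_basis_Sh2 :: "nat \<Rightarrow> nat \<Rightarrow> (nat \<Rightarrow> real \<Rightarrow> real) \<Rightarrow> bool" where
  "orthonormal_basis_Sh2 N m q \<longleftrightarrow>
     (\<forall>k<m. q k \<in> Sh2 N) \<and>
     (\<forall>k<m. \<forall>l<m. L2_inner (q k) (q l) = (if k = l then 1 else 0)) \<and>
     (\<forall>\<phi>\<in>Sh2 N. \<forall>x\<in>{0..1}. \<phi> x = (\<Sum>k<m. L2_inner \<phi> (q k) * q k x))"

lemma orthonormal_basis_Sh2D:
  assumes "orthonormal_basis_Sh2 N m q"
  shows "k < m \<Longrightarrow> q k \<in> Sh2 N"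
    and "k < m \<Longrightarrow> l < m \<Longrightarrow> L2_inner (q k) (q l) = (if k = l then 1 else 0)"
    and "\<phi> \<in> Sh2 N \<Longrightarrow> x \<in> {0..1} \<Longrightarrow> \<phi> x = (\<Sum>k<m. L2_inner \<phi> (q k) * q k x)"
  using assms unfolding orthonormal_basis_Sh2_def by blast+

text \<open>
  Gram-Schmidt on the hat functions. The induction is on the number \<open>n\<close> of leading nodes at which
  a function may be nonzero: subtracting the multiple of \<open>hat N n\<close> with the same value at node \<open>n\<close>
  lowers that number by one.
\<close>
lemma orthonormal_basis_Sh2_exists:
  assumes N: "N > 0"
  shows "\<exists>m q. orthonormal_basis_Sh2 N m q"
proof -
  have ind: "\<exists>(m::nat) q. (\<forall>k<m. q k \<in> Sh2 N)
      \<and> (\<forall>k<m. \<forall>l<m. L2_inner (q k) (q l) = (if k = l then 1 else 0))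
      \<and> (\<forall>\<phi>\<in>Sh2 N. (\<forall>j. n \<le> j \<and> j \<le> N \<longrightarrow> \<phi> (node N j) = 0) \<longrightarrow>
            (\<exists>c. \<forall>x\<in>{0..1}. \<phi> x = (\<Sum>k<m. c k * q k x)))" if "n \<le> Suc N" for n
    using that
  proof (induction n)
    case 0
    have "\<phi> x = 0" if "\<phi> \<in> Sh2 N" "\<forall>j. 0 \<le> j \<and> j \<le> N \<longrightarrow> \<phi> (node N j) = 0" "x \<in> {0..1}" for \<phi> x
      by (rule Sh2_eqI[OF N that(1) Sh2_zero[OF N] _ that(3)]) (use that in auto)
    then show ?case by (intro exI[of _ 0]) auto
  next
    case (Suc n)
    then obtain m :: nat and q where
      q: "\<And>k. k < m \<Longrightarrow> q k \<in> Sh2 N"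
      and on: "\<And>k l. k < m \<Longrightarrow> l < m \<Longrightarrow> L2_inner (q k) (q l) = (if k = l then 1 else 0)"
      and sp: "\<And>\<phi>. \<phi> \<in> Sh2 N \<Longrightarrow> (\<forall>j. n \<le> j \<and> j \<le> N \<longrightarrow> \<phi> (node N j) = 0) \<Longrightarrow>
            (\<exists>c. \<forall>x\<in>{0..1}. \<phi> x = (\<Sum>k<m. c k * q k x))"
    proof -
      from Suc.prems have "n \<le> Suc N" by simp
      from Suc.IH[OF this] show ?thesis using that by blast
    qed
    let ?H = "hat N n"
    have H: "?H \<in> Sh2 N" by (rule hat_Sh2[OF N])
    define b where "b = (\<lambda>k. L2_inner ?H (q k))"
    define s where "s = (\<lambda>x. \<Sum>k<m. b k * q k x)"
    define r where "r = (\<lambda>x. ?H x - s x)"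
    have s: "s \<in> Sh2 N" unfolding s_def by (rule Sh2_sum[OF N]) (use q in auto)
    have r: "r \<in> Sh2 N" unfolding r_def by (rule Sh2_diff[OF N H s])
    have sq: "L2_inner s (q l) = b l" if "l < m" for l
      unfolding s_def using q on that by (intro L2_inner_orthonormal_sum) (auto intro: Sh2_continuous)
    have rq: "L2_inner r (q l) = 0" if "l < m" for l
      unfolding r_def
      using L2_inner_diff_left[OF Sh2_continuous[OF H] Sh2_continuous[OF s] Sh2_continuous[OF q[OF that]]]
        sq[OF that] by (simp add: b_def)
    have split: "\<exists>a c. \<forall>x\<in>{0..1}. \<phi> x = a * r x + (\<Sum>k<m. c k * q k x)"
      if \<phi>: "\<phi> \<in> Sh2 N" and z: "\<forall>j. Suc n \<le> j \<and> j \<le> N \<longrightarrow> \<phi> (node N j) = 0" for \<phi>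
    proof -
      define a where "a = \<phi> (node N n)"
      have 1: "(\<lambda>x. \<phi> x - a * ?H x) \<in> Sh2 N"
        using Sh2_lincomb[OF N \<phi> H, of 1 "- a"] by simp
      have "\<phi> (node N j) - a * ?H (node N j) = 0" if "n \<le> j \<and> j \<le> N" for j
        using that z by (cases "j = n") (auto simp: a_def hat_node[OF N])
      then obtain c where c: "\<forall>x\<in>{0..1}. \<phi> x - a * ?H x = (\<Sum>k<m. c k * q k x)"
        using sp[OF 1] by blast
      have "\<phi> x = a * r x + (\<Sum>k<m. (a * b k + c k) * q k x)" if "x \<in> {0..1}" for x
      proof -
        have "(\<Sum>k<m. (a * b k + c k) * q k x) = a * s x + (\<Sum>k<m. c k * q k x)"
          by (simp add: s_def sum_distrib_left sum.distrib algebra_simps)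
        then show ?thesis using bspec[OF c that] by (simp add: r_def algebra_simps)
      qed
      then show ?thesis by (intro exI[of _ a] exI[of _ "\<lambda>k. a * b k + c k"]) blast
    qed
    have D0: "L2_inner r r \<ge> 0"
      unfolding L2_inner_Sh2[OF N r r] by (intro sum_nonneg add_nonneg_nonneg) auto
    show ?case
      \<comment> \<open>A zero remainder means that the hat function lies in the span already; no vector is added then.\<close>
    proof (cases "L2_inner r r = 0")
      case True
      have "r x = 0" if "x \<in> {0..1}" for x
        using Sh2_sup_bound[OF N r that] True by simp
      then have "\<exists>c. \<forall>x\<in>{0..1}. \<phi> x = (\<Sum>k<m. c k * q k x)"
        if "\<phi> \<in> Sh2 N" "\<forall>j. Suc n \<le> j \<and> j \<le> N \<longrightarrow> \<phi> (node N j) = 0" for \<phi>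
        using split[OF that] by auto
      then show ?thesis using q on by (intro exI[of _ m] exI[of _ q]) auto
    next
      case False
      define D where "D = sqrt (L2_inner r r)"
      have D: "D > 0" "D * D = L2_inner r r" using False D0 by (auto simp: D_def)
      define q' where "q' = q(m := (\<lambda>x. (1/D) * r x))"
      have qm: "q' m = (\<lambda>x. (1/D) * r x)" and qk: "\<And>k. k < m \<Longrightarrow> q' k = q k"
        by (auto simp: q'_def)
      have mem: "q' k \<in> Sh2 N" if "k < Suc m" for k
        using that q Sh2_scale[OF N r, of "1/D"] qm qk by (cases "k = m") auto
      have mq: "L2_inner (q' m) (q' k) = 0" if "k < m" for k
        unfolding qm qk[OF that]
        using L2_inner_scale_left[OF Sh2_continuous[OF r] Sh2_continuous[OF q[OF that]], of "1/D"] rq[OF that]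
        by simp
      have mm: "L2_inner (q' m) (q' m) = 1"
      proof -
        have rc: "continuous_on {0..1} r" by (rule Sh2_continuous[OF r])
        define g where "g = (\<lambda>x. (1/D) * r x)"
        have gc: "continuous_on {0..1} g" unfolding g_def by (intro continuous_on_mult_left rc)
        have 1: "L2_inner g k = 1/D * L2_inner r k" if "continuous_on {0..1} k" for k
          unfolding g_def by (rule L2_inner_scale_left[OF rc that])
        have "L2_inner g g = 1/D * L2_inner g r"
          using 1[OF gc] by (simp add: L2_inner_commute[of r g])
        also have "\<dots> = 1/D * (1/D * L2_inner r r)" by (simp only: 1[OF rc])
        also have "\<dots> = 1" unfolding D(2)[symmetric] using D(1) by simp
        finally show ?thesis unfolding qm g_def .
      qed
      have ortho: "L2_inner (q' k) (q' l) = (if k = l then 1 else 0)" if "k < Suc m" "l < Suc m" for k l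
        using that mq mm on qk L2_inner_commute[of "q' k" "q' l"]
        by (cases "k = m"; cases "l = m") auto
      have span: "\<exists>c. \<forall>x\<in>{0..1}. \<phi> x = (\<Sum>k<Suc m. c k * q' k x)"
        if h: "\<phi> \<in> Sh2 N" "\<forall>j. Suc n \<le> j \<and> j \<le> N \<longrightarrow> \<phi> (node N j) = 0" for \<phi>
      proof -
        obtain a c where ac: "\<forall>x\<in>{0..1}. \<phi> x = a * r x + (\<Sum>k<m. c k * q k x)"
          using split[OF h] by blast
        let ?c = "c(m := a * D)"
        have "(\<Sum>k<Suc m. ?c k * q' k x) = a * r x + (\<Sum>k<m. c k * q k x)" for x
        proof -
          have "(\<Sum>k<m. ?c k * q' k x) = (\<Sum>k<m. c k * q k x)"
            by (intro sum.cong) (auto simp: qk)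
          then show ?thesis using D by (simp add: qm)
        qed
        then show ?thesis using ac by (intro exI[of _ ?c]) simp
      qed
      show ?thesis
        using mem ortho span by (intro exI[of _ "Suc m"] exI[of _ q']) blast
    qed
  qed
  obtain m :: nat and q where
    q: "\<And>k. k < m \<Longrightarrow> q k \<in> Sh2 N"
    and on: "\<And>k l. k < m \<Longrightarrow> l < m \<Longrightarrow> L2_inner (q k) (q l) = (if k = l then 1 else 0)"
    and sp': "\<And>\<phi>. \<phi> \<in> Sh2 N \<Longrightarrow> (\<forall>j. Suc N \<le> j \<and> j \<le> N \<longrightarrow> \<phi> (node N j) = 0)
        \<Longrightarrow> (\<exists>c. \<forall>x\<in>{0..1}. \<phi> x = (\<Sum>k<m. c k * q k x))"
    using ind[OF le_refl] by blast
  have sp: "\<exists>c. \<forall>x\<in>{0..1}. \<phi> x = (\<Sum>k<m. c k * q k x)" if "\<phi> \<in> Sh2 N" for \<phi>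
    by (rule sp'[OF that]) auto
  have "\<phi> x = (\<Sum>k<m. L2_inner \<phi> (q k) * q k x)" if \<phi>: "\<phi> \<in> Sh2 N" and x: "x \<in> {0..1}" for \<phi> x
  proof -
    obtain c where c: "\<And>x. x \<in> {0..1} \<Longrightarrow> \<phi> x = (\<Sum>k<m. c k * q k x)" using sp[OF \<phi>] by blast
    have "L2_inner \<phi> (q l) = c l" if "l < m" for l
    proof -
      have "L2_inner \<phi> (q l) = L2_inner (\<lambda>x. \<Sum>k<m. c k * q k x) (q l)"
        by (rule L2_inner_cong[OF c])
      also have "\<dots> = c l"
        using q on that by (intro L2_inner_orthonormal_sum) (auto intro: Sh2_continuous)
      finally show ?thesis .
    qed
    then show ?thesis using c[OF x] by simp
  qed
  then have "orthonormal_basis_Sh2 N m q"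
    using q on unfolding orthonormal_basis_Sh2_def by blast
  then show ?thesis by blast
qed

text \<open>
  \<open>Pf\<close> is the \<open>L\<^sup>2\<close>-projection of \<open>f\<close>. In this form it depends on \<open>f\<close> only through finitely many
  inner products, so it can be differentiated in time when \<open>f\<close> depends on time.
\<close>
lemma L2_inner_projection:
  fixes m :: nat and q :: "nat \<Rightarrow> real \<Rightarrow> real"
  assumes basis: "orthonormal_basis_Sh2 N m q" and f: "continuous_on {0..1} f"
  defines "Pf \<equiv> \<lambda>x. \<Sum>k<m. L2_inner f (q k) * q k x"
  shows "\<phi> \<in> Sh2 N \<Longrightarrow> L2_inner Pf \<phi> = L2_inner f \<phi>"
    and "L2_inner Pf Pf = (\<Sum>k<m. (L2_inner f (q k))\<^sup>2)"
proof -
  note q = orthonormal_basis_Sh2D(1)[OF basis] and on = orthonormal_basis_Sh2D(2)[OF basis]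
    and sp = orthonormal_basis_Sh2D(3)[OF basis]
  have qc: "continuous_on {0..1} (q k)" if "k < m" for k
    using q[OF that] by (rule Sh2_continuous)
  have Pc: "continuous_on {0..1} Pf"
    unfolding Pf_def by (intro continuous_on_sum continuous_on_mult_left qc) simp
  have co: "L2_inner Pf (q l) = L2_inner f (q l)" if "l < m" for l
    unfolding Pf_def by (rule L2_inner_orthonormal_sum[OF qc on that])
  show "L2_inner Pf \<phi> = L2_inner f \<phi>" if \<phi>: "\<phi> \<in> Sh2 N"
  proof -
    have "L2_inner g \<phi> = (\<Sum>k<m. L2_inner \<phi> (q k) * L2_inner g (q k))" if g: "continuous_on {0..1} g" for g
    proof -
      have "L2_inner g \<phi> = L2_inner (\<lambda>x. \<Sum>k<m. L2_inner \<phi> (q k) * q k x) g"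
        unfolding L2_inner_commute[of g] by (rule L2_inner_cong[OF sp[OF \<phi>]])
      also have "\<dots> = (\<Sum>k<m. L2_inner \<phi> (q k) * L2_inner (q k) g)"
        by (rule L2_inner_sum_left[OF _ _ g]) (auto intro: qc)
      finally show ?thesis by (simp add: L2_inner_commute[of _ g])
    qed
    from this[OF Pc] this[OF f] co show ?thesis by simp
  qed
  have "L2_inner Pf Pf = (\<Sum>k<m. L2_inner f (q k) * L2_inner (q k) Pf)"
    unfolding Pf_def by (rule L2_inner_sum_left[OF _ _ Pc[unfolded Pf_def]]) (auto intro: qc)
  also have "\<dots> = (\<Sum>k<m. (L2_inner f (q k))\<^sup>2)"
    using co by (intro sum.cong) (auto simp: L2_inner_commute[of _ Pf] power2_eq_square)
  finally show "L2_inner Pf Pf = (\<Sum>k<m. (L2_inner f (q k))\<^sup>2)" .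
qed

section \<open>Superconvergence of the projection to the corrected interpolant\<close>

definition corrected_interpolant :: "nat \<Rightarrow> (real \<Rightarrow> real) \<Rightarrow> real \<Rightarrow> real" where
  "corrected_interpolant N f = interpolant N (\<lambda>x. f x - (1 / real N)\<^sup>2 / 12 * (deriv01 ^^ 2) f x)"

lemma corrected_interpolant_Sh2: "N > 0 \<Longrightarrow> corrected_interpolant N f \<in> Sh2 N"
  unfolding corrected_interpolant_def by (rule interpolant_Sh2)

lemma corrected_interpolant_error:
  assumes N: "N > 0" and j: "j < N" and f: "f \<in> Ck_space 4"
    and M: "derivs_bounded 4 f M"
  defines "h \<equiv> 1 / real N" and "\<rho> \<equiv> \<lambda>x. f x - corrected_interpolant N f x"
    and "m \<equiv> midpt N j"
  shows "x \<in> elem N j \<Longrightarrow> \<bar>\<rho> x\<bar> \<le> 2 * M * h\<^sup>2"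
    and "\<bar>integral (elem N j) \<rho>\<bar> \<le> M * h^5"
    and "\<bar>integral (elem N j) (\<lambda>x. (x - m) * \<rho> x) - h^5 * (deriv01 ^^ 3) f m / 180\<bar> \<le> M * h^6"
    and "x \<in> elem N j \<Longrightarrow> \<bar>(deriv01 ^^ 3) f x - (deriv01 ^^ 3) f m\<bar> \<le> M * h"
proof -
  let ?D = "\<lambda>i. (deriv01 ^^ i) f"
  define w where "w = (\<lambda>x. f x - h\<^sup>2/12 * ?D 2 x)"
  have h: "0 < h" "h \<le> 1" using N by (simp_all add: h_def)
  have el: "elem N j = {m - h/2..m + h/2}"
    unfolding m_def h_def by (rule elem_eq[OF N])
  have sub: "{m - h/2..m + h/2} \<subseteq> {0..1}" using elem_subset[OF N j] el by simp
  have mI: "m \<in> {m - h/2..m + h/2}" using h by auto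
  have d: "(?D i has_real_derivative ?D (Suc i) x) (at x within {m - h/2..m + h/2})"
    if "i < 4" "x \<in> {m - h/2..m + h/2}" for i x
    using Ck_space_derivative[OF f that(1), of x] that(2) sub by (meson DERIV_subset subsetD)
  have d0: "(f has_real_derivative ?D 1 x) (at x within {m - h/2..m + h/2})"
      and d1: "(?D 1 has_real_derivative ?D 2 x) (at x within {m - h/2..m + h/2})"
      and d2: "(?D 2 has_real_derivative ?D 3 x) (at x within {m - h/2..m + h/2})"
      and d3: "(?D 3 has_real_derivative ?D 4 x) (at x within {m - h/2..m + h/2})"
    if "x \<in> {m - h/2..m + h/2}" for x
    using d[of 0 x] d[of 1 x] d[of 2 x] d[of 3 x] that by (simp_all add: eval_nat_numeral)
  have M4: "\<bar>?D 4 x\<bar> \<le> M" if "x \<in> {m - h/2..m + h/2}" for x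
    using derivs_boundedD[OF M, of 4 x] that sub by auto
  have w: "w x = f x - h\<^sup>2/12 * ?D 2 x" for x by (simp add: w_def)
  have def: "\<bar>f x - ((w (m-h/2) + w (m+h/2))/2 + (w (m+h/2) - w (m-h/2))/h*(x-m))
          - (?D 2 m/2*((x-m)\<^sup>2 - h\<^sup>2/12) + ?D 3 m/6*((x-m)^3 + h\<^sup>2/4*(x-m)))\<bar> \<le> M * h^4"
    "\<bar>?D 3 x - ?D 3 m\<bar> \<le> M * h" if "x \<in> {m - h/2..m + h/2}" for x
    by (rule corrected_interpolation_defect[where f = f and ?f1.0 = "?D 1" and ?f2.0 = "?D 2"
          and ?f3.0 = "?D 3" and ?f4.0 = "?D 4"]; (fact | rule d0 d1 d2 d3 M4 w; assumption))+
  have ci: "corrected_interpolant N f \<in> Sh2 N" by (rule corrected_interpolant_Sh2[OF N])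
  have nodes: "corrected_interpolant N f (node N i) = w (node N i)" if "i \<le> N" for i
    using interpolant_node[OF N that] by (simp add: corrected_interpolant_def w_def h_def)
  have ends: "node N j = m - h/2" "node N (Suc j) = m + h/2"
    unfolding m_def h_def by (rule elem_ends[OF N])+
  have cv: "corrected_interpolant N f x = (w (m-h/2) + w (m+h/2))/2 + (w (m+h/2) - w (m-h/2))/h*(x-m)"
    if "x \<in> {m - h/2..m + h/2}" for x
    using Sh2_on_elem[OF N ci j, of x] that el nodes[of j] nodes[of "Suc j"] j
    by (simp add: mean_def slope_def ends m_def[symmetric] h_def)
  have \<rho>: "\<bar>\<rho> x - (?D 2 m/2*((x-m)\<^sup>2 - h\<^sup>2/12) + ?D 3 m/6*((x-m)^3 + h\<^sup>2/4*(x-m)))\<bar> \<le> M * h^4"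
    if "x \<in> {m - h/2..m + h/2}" for x
    using def(1)[OF that] cv[OF that] by (simp add: \<rho>_def)
  have "continuous_on {0..1} \<rho>"
    unfolding \<rho>_def using Ck_space_continuous[OF f, of 0] Sh2_continuous[OF ci]
    by (intro continuous_intros) auto
  then have cont: "continuous_on {m - h/2..m + h/2} \<rho>"
    using continuous_on_subset sub by blast
  have M2: "\<bar>?D 2 m\<bar> \<le> M" and M3: "\<bar>?D 3 m\<bar> \<le> M"
    using derivs_boundedD[OF M, of 2 m] derivs_boundedD[OF M, of 3 m] mI sub by auto
  have mom: "\<bar>\<rho> x\<bar> \<le> 2 * M * h\<^sup>2" if "x \<in> {m - h/2..m + h/2}" for x
    by (rule defect_moments(1)[OF h M2 M3 cont _ that]) (rule \<rho>)
  have mom2: "\<bar>integral {m - h/2..m + h/2} \<rho>\<bar> \<le> M * h^5"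
    by (rule defect_moments(2)[OF h M2 M3 cont]) (rule \<rho>)
  have mom3: "\<bar>integral {m - h/2..m + h/2} (\<lambda>x. (x-m) * \<rho> x) - h^5 * ?D 3 m / 180\<bar> \<le> M * h^6"
    by (rule defect_moments(3)[OF h M2 M3 cont]) (rule \<rho>)
  show "x \<in> elem N j \<Longrightarrow> \<bar>\<rho> x\<bar> \<le> 2 * M * h\<^sup>2"
    using mom el by simp
  show "\<bar>integral (elem N j) \<rho>\<bar> \<le> M * h^5"
    unfolding el by (rule mom2)
  show "\<bar>integral (elem N j) (\<lambda>x. (x - m) * \<rho> x) - h^5 * ?D 3 m / 180\<bar> \<le> M * h^6"
    unfolding el by (rule mom3)
  show "\<bar>?D 3 x - ?D 3 m\<bar> \<le> M * h" if "x \<in> elem N j"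
    using def(2)[of x] that el by simp
qed

lemma weighted_defect_element:
  assumes N: "N > 0" and j: "j < N" and f: "f \<in> Ck_space 4"
    and M: "derivs_bounded 4 f M"
    and u: "u \<in> Ck_space 2"
    and U: "derivs_bounded 2 u U"
  shows "\<bar>integral (elem N j) (\<lambda>x. u x * (f x - corrected_interpolant N f x))\<bar> \<le> 5 * U * M * (1 / real N)^5"
proof -
  define h where "h = 1 / real N"
  define m where "m = midpt N j"
  define \<rho> where "\<rho> = (\<lambda>x. f x - corrected_interpolant N f x)"
  have h: "0 < h" "h \<le> 1" using N by (simp_all add: h_def)
  have el: "elem N j = {m - h/2..m + h/2}"
    unfolding m_def h_def by (rule elem_eq[OF N])
  have sub: "{m - h/2..m + h/2} \<subseteq> {0..1}" using elem_subset[OF N j] el by simp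
  have mI: "m \<in> {0..1}" using h sub by auto
  note err = corrected_interpolant_error[OF N j f M, folded h_def m_def, unfolded el]
  have "continuous_on {0..1} \<rho>"
    unfolding \<rho>_def using Ck_space_continuous[OF f, of 0] Sh2_continuous[OF corrected_interpolant_Sh2[OF N]]
    by (intro continuous_intros) auto
  then have cont: "continuous_on {m - h/2..m + h/2} \<rho>"
    using continuous_on_subset sub by blast
  have d: "((deriv01 ^^ i) u has_real_derivative (deriv01 ^^ Suc i) u x) (at x within {m - h/2..m + h/2})"
    if "i < 2" "x \<in> {m - h/2..m + h/2}" for i x
    using Ck_space_derivative[OF u that(1), of x] that(2) sub by (meson DERIV_subset subsetD)
  have I0: "\<bar>integral {m - h/2..m + h/2} \<rho>\<bar> \<le> M * h^5"
    and I1: "\<bar>integral {m - h/2..m + h/2} (\<lambda>x. (x-m) * \<rho> x) - h^5 * (deriv01 ^^ 3) f m / 180\<bar> \<le> M * h^6"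
    using err(2,3) by (simp_all add: \<rho>_def)
  have "\<bar>integral {m - h/2..m + h/2} (\<lambda>x. u x * \<rho> x)\<bar> \<le> 5 * U * M * h^5"
  proof (rule defect_weighted_integral[OF h _ cont _ I0 I1, where ?u1.0 = "deriv01 u" and ?u2.0 = "(deriv01 ^^ 2) u"])
    show "\<bar>\<rho> x\<bar> \<le> 2 * M * h\<^sup>2" if "x \<in> {m - h/2..m + h/2}" for x
      using err(1)[OF that] by (simp add: \<rho>_def)
    show "\<bar>(deriv01 ^^ 3) f m\<bar> \<le> M" using derivs_boundedD[OF M, of 3 m] mI by simp
    show "(u has_real_derivative deriv01 u x) (at x within {m - h/2..m + h/2})"
      if "x \<in> {m - h/2..m + h/2}" for x using d[of 0 x] that by simp
    show "(deriv01 u has_real_derivative (deriv01 ^^ 2) u x) (at x within {m - h/2..m + h/2})"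
      if "x \<in> {m - h/2..m + h/2}" for x using d[of 1 x] that by (simp add: eval_nat_numeral)
    show "\<bar>u m\<bar> \<le> U" using derivs_boundedD[OF U, of 0 m] mI by simp
    show "\<bar>deriv01 u m\<bar> \<le> U" using derivs_boundedD[OF U, of 1 m] mI by simp
    show "\<bar>(deriv01 ^^ 2) u x\<bar> \<le> U" if "x \<in> {m - h/2..m + h/2}" for x
      using derivs_boundedD[OF U, of 2 x] sub that by auto
  qed
  then show ?thesis unfolding el h_def \<rho>_def .
qed

text \<open>
  The hypothesis on \<open>e\<close> holds for the difference of the \<open>L\<^sup>2\<close>-projection and the corrected interpolant
  of \<open>f\<close>. Estimating \<open>(\<rho>, e)\<close> by the first moments of \<open>\<rho>\<close> on the elements gives only \<open>\<parallel>e\<parallel> = O(h\<^sup>3)\<close>.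
  The gain of half a power comes from cancellation between neighbours: up to smaller terms, the
  contribution of an element is \<open>h\<^sup>4/180\<close> times the increment of \<open>f3 e\<close> over it. On a uniform mesh
  these increments have a common factor and add up to boundary values of \<open>f3 e\<close>, where \<open>f3\<close> is the
  third derivative of \<open>f\<close>, and by the inverse inequality \<open>e\<close> is there bounded by \<open>C h\<^sup>-\<^sup>1\<^sup>/\<^sup>2 \<parallel>e\<parallel>\<close>.
\<close>
lemma projection_defect_bound:
  assumes N: "N > 0" and f: "f \<in> Ck_space 4"
    and M: "derivs_bounded 4 f M"
    and e: "e \<in> Sh2 N" and ee: "L2_inner e e = L2_inner (\<lambda>x. f x - corrected_interpolant N f x) e"
  shows "L2_inner e e \<le> 256 * M\<^sup>2 * (1 / real N)^7"
proof -
  define h where "h = 1 / real N"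
  define \<rho> where "\<rho> = (\<lambda>x. f x - corrected_interpolant N f x)"
  define E where "E = L2_inner e e"
  let ?D3 = "(deriv01 ^^ 3) f"
  have h: "0 < h" "h \<le> 1" using N by (simp_all add: h_def)
  have M0: "0 \<le> M" using derivs_boundedD[OF M, of 0 0] by simp
  have cont: "continuous_on {0..1} \<rho>"
    unfolding \<rho>_def using Ck_space_continuous[OF f, of 0] Sh2_continuous[OF corrected_interpolant_Sh2[OF N]]
    by (intro continuous_intros) auto
  let ?c = "mean N e" and ?s = "slope N e"
  let ?q = "\<lambda>j. h * (?c j * ?c j) + h^3 / 12 * (?s j * ?s j)"
  let ?b = "\<lambda>j. ?D3 (node N j) * e (node N j)"
  have loc: "?c j * integral (elem N j) \<rho> + ?s j * integral (elem N j) (\<lambda>x. (x - midpt N j) * \<rho> x)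
      \<le> h^4/180 * (?b (Suc j) - ?b j) + ?q j / 4 + 52 * M\<^sup>2 * h^9" if j: "j < N" for j
  proof -
    define A where "A = ?D3 (node N j)"
    define B where "B = ?D3 (node N (Suc j))"
    define D where "D = ?D3 (midpt N j)"
    define I0 where "I0 = integral (elem N j) \<rho>"
    define R where "R = integral (elem N j) (\<lambda>x. (x - midpt N j) * \<rho> x) - h^5 * D / 180"
    note err = corrected_interpolant_error[OF N j f M, folded h_def]
    have I0: "\<bar>I0\<bar> \<le> M * h^5" using err(2) by (simp add: I0_def \<rho>_def)
    have R: "\<bar>R\<bar> \<le> M * h^6" using err(3) by (simp add: R_def D_def \<rho>_def)
    have AB: "\<bar>A - D\<bar> \<le> M * h" "\<bar>B - D\<bar> \<le> M * h"
      using err(4)[of "node N j"] err(4)[of "node N (Suc j)"] node_less[OF N, of j]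
      by (simp_all add: A_def B_def D_def)
    have ends: "e (node N j) = ?c j - ?s j * h / 2" "e (node N (Suc j)) = ?c j + ?s j * h / 2"
      using N by (simp_all add: mean_def slope_def h_def field_simps)
    have eq: "?c j * I0 + ?s j * (R + h^5 * D / 180) - h^4/180 * (?b (Suc j) - ?b j)
       = ?c j * (I0 - h^4/180 * ((B - D) - (A - D)))
         + ?s j * (R - h^4/180 * (h/2 * ((A - D) + (B - D))))"
      unfolding ends A_def[symmetric] B_def[symmetric] by (simp add: field_simps eval_nat_numeral)
    have k: "0 \<le> M * h^5" "0 \<le> M * h^6" using M0 h by simp_all
    have "\<bar>h^4/180 * ((B - D) - (A - D))\<bar> \<le> h^4/180 * (2 * (M * h))"
      unfolding abs_mult using AB h by (intro mult_mono) auto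
    also have "\<dots> = M * h^5 / 90" by (simp add: eval_nat_numeral)
    finally have 1: "\<bar>I0 - h^4/180 * ((B - D) - (A - D))\<bar> \<le> 2 * (M * h^5)"
      using I0 k by linarith
    have "\<bar>h^4/180 * (h/2 * ((A - D) + (B - D)))\<bar> \<le> h^4/180 * (h/2 * (2 * (M * h)))"
      unfolding abs_mult using AB h by (intro mult_mono) auto
    also have "\<dots> = M * h^6 / 180" by (simp add: eval_nat_numeral)
    finally have 2: "\<bar>R - h^4/180 * (h/2 * ((A - D) + (B - D)))\<bar> \<le> 2 * (M * h^6)"
      using R k by linarith
    have "?c j * (I0 - h^4/180 * ((B - D) - (A - D))) \<le> \<bar>?c j\<bar> * (2 * (M * h^5))"
      using mult_left_mono[OF 1 abs_ge_zero[of "?c j"]] by (simp add: abs_mult[symmetric])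
    moreover have "?s j * (R - h^4/180 * (h/2 * ((A - D) + (B - D)))) \<le> \<bar>?s j\<bar> * (2 * (M * h^6))"
      using mult_left_mono[OF 2 abs_ge_zero[of "?s j"]] by (simp add: abs_mult[symmetric])
    moreover have "\<bar>?c j\<bar> * (2 * (M * h^5)) \<le> h * (?c j * ?c j) / 4 + 4 * M\<^sup>2 * h^9"
    proof -
      \<comment> \<open>Here and below, Young's inequality in the form of a completed square.\<close>
      have "0 \<le> h/4 * (\<bar>?c j\<bar> - 4 * M * h^4)\<^sup>2" using h by simp
      also have "\<dots> = h * (?c j * ?c j) / 4 - \<bar>?c j\<bar> * (2 * (M * h^5)) + 4 * M\<^sup>2 * h^9"
        by (simp add: power2_diff power2_eq_square) (simp add: field_simps eval_nat_numeral)
      finally show ?thesis by linarith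
    qed
    moreover have "\<bar>?s j\<bar> * (2 * (M * h^6)) \<le> h^3 / 12 * (?s j * ?s j) / 4 + 48 * M\<^sup>2 * h^9"
    proof -
      have "0 \<le> h^3/48 * (\<bar>?s j\<bar> - 48 * M * h^3)\<^sup>2" using h by simp
      also have "\<dots> = h^3 / 12 * (?s j * ?s j) / 4 - \<bar>?s j\<bar> * (2 * (M * h^6)) + 48 * M\<^sup>2 * h^9"
        by (simp add: power2_diff power2_eq_square) (simp add: field_simps eval_nat_numeral)
      finally show ?thesis by linarith
    qed
    ultimately have "?c j * I0 + ?s j * (R + h^5 * D / 180) - h^4/180 * (?b (Suc j) - ?b j)
       \<le> ?q j / 4 + 52 * M\<^sup>2 * h^9"
      unfolding eq by (simp add: add_divide_distrib)
    then show ?thesis by (simp add: I0_def R_def)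
  qed
  have EQ: "E = (\<Sum>j<N. ?q j)"
    unfolding E_def L2_inner_Sh2[OF N e e] h_def ..
  have "E = (\<Sum>j<N. ?c j * integral (elem N j) \<rho> + ?s j * integral (elem N j) (\<lambda>x. (x - midpt N j) * \<rho> x))"
    unfolding E_def ee using L2_inner_continuous_Sh2[OF N cont e] by (simp add: \<rho>_def)
  also have "\<dots> \<le> (\<Sum>j<N. h^4/180 * (?b (Suc j) - ?b j) + ?q j / 4 + 52 * M\<^sup>2 * h^9)"
    by (intro sum_mono loc) auto
  also have "\<dots> = h^4/180 * (\<Sum>j<N. ?b (Suc j) - ?b j) + E / 4 + real N * (52 * M\<^sup>2 * h^9)"
  proof -
    have "(\<Sum>j<N. k * a j + b j / 4 + c) = k * (\<Sum>j<N. a j) + (\<Sum>j<N. b j) / 4 + real N * c"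
      for a b :: "nat \<Rightarrow> real" and k c
      by (simp add: sum.distrib sum_distrib_left sum_divide_distrib)
    then show ?thesis unfolding EQ .
  qed
  also have "(\<Sum>j<N. ?b (Suc j) - ?b j) = ?D3 1 * e 1 - ?D3 0 * e 0"
    using sum_lessThan_telescope[of ?b N] N by simp
  also have "real N * (52 * M\<^sup>2 * h^9) = 52 * M\<^sup>2 * h^8"
    using N by (simp add: h_def eval_nat_numeral)
  finally have main: "E \<le> h^4/180 * (?D3 1 * e 1 - ?D3 0 * e 0) + E / 4 + 52 * M\<^sup>2 * h^8" .
  have bd: "h^4 * (M * \<bar>e x\<bar>) \<le> E / 4 + 6 * M\<^sup>2 * h^7" if "x \<in> {0..1}" for x
  proof -
    have "(e x)\<^sup>2 \<le> 6 / h * E" using Sh2_sup_bound[OF N e that] by (simp add: E_def h_def)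
    then have "h / 24 * (e x)\<^sup>2 \<le> h / 24 * (6 / h * E)" using h by (intro mult_left_mono) auto
    then have "h / 24 * (e x)\<^sup>2 \<le> E / 4" using h by simp
    moreover have "0 \<le> h/24 * (\<bar>e x\<bar> - 12 * M * h^3)\<^sup>2" using h by simp
    moreover have "h/24 * (\<bar>e x\<bar> - 12 * M * h^3)\<^sup>2 = h / 24 * (e x)\<^sup>2 - h^4 * (M * \<bar>e x\<bar>) + 6 * M\<^sup>2 * h^7"
      by (simp add: power2_diff power2_eq_square) (simp add: field_simps eval_nat_numeral)
    ultimately show ?thesis by linarith
  qed
  have "h^4/180 * (?D3 1 * e 1 - ?D3 0 * e 0) \<le> h^4 * (M * \<bar>e 1\<bar> + M * \<bar>e 0\<bar>)"
  proof -
    have "\<bar>?D3 1 * e 1\<bar> \<le> M * \<bar>e 1\<bar>" "\<bar>?D3 0 * e 0\<bar> \<le> M * \<bar>e 0\<bar>"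
      unfolding abs_mult using derivs_boundedD[OF M, of 3 1] derivs_boundedD[OF M, of 3 0] by (intro mult_right_mono; simp)+
    then have "?D3 1 * e 1 - ?D3 0 * e 0 \<le> M * \<bar>e 1\<bar> + M * \<bar>e 0\<bar>" by linarith
    moreover have "0 \<le> M * \<bar>e 1\<bar> + M * \<bar>e 0\<bar>" using M0 by simp
    moreover have "1/180 * X \<le> Y" if "X \<le> Y" "0 \<le> Y" for X Y :: real using that by linarith
    ultimately have "1/180 * (?D3 1 * e 1 - ?D3 0 * e 0) \<le> M * \<bar>e 1\<bar> + M * \<bar>e 0\<bar>" by blast
    from mult_left_mono[OF this, of "h^4"] h show ?thesis by simp
  qed
  also have "\<dots> \<le> E / 2 + 12 * M\<^sup>2 * h^7"
    using bd[of 0] bd[of 1] by (simp add: algebra_simps)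
  finally have "E \<le> E / 2 + 12 * M\<^sup>2 * h^7 + E / 4 + 52 * M\<^sup>2 * h^8" using main by linarith
  moreover have "M\<^sup>2 * h^8 \<le> M\<^sup>2 * h^7"
    using h by (intro mult_left_mono power_decreasing) auto
  ultimately have "E \<le> 256 * (M\<^sup>2 * h^7)" by linarith
  then show ?thesis by (simp add: E_def h_def)
qed

section \<open>The energy estimate\<close>

text \<open>
  The left-hand side is \<open>2 \<integral> u (\<theta> + e - \<rho>) \<theta>'\<close> with \<open>\<rho>\<close> the defect of the corrected interpolant.
  The first part is \<open>- \<integral> u' \<theta>\<^sup>2\<close>, the stability of the scheme. In the others the factor \<open>\<theta>'\<close>
  costs \<open>h\<^sup>-\<^sup>1\<close>, which the size of \<open>e\<close> and the smallness of \<open>\<integral> u \<rho>\<close> on each element make up for;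
  the constant is \<open>72 * 256 + 300\<close>.
\<close>
lemma energy_rate_bound:
  assumes N: "N > 0" and f: "f \<in> Ck_space 4"
    and M: "derivs_bounded 4 f M"
    and u: "u \<in> Ck_space 2" "u 0 = 0" "u 1 = 0"
    and U: "derivs_bounded 2 u U"
    and \<theta>: "\<theta> \<in> Sh2 N" and e: "e \<in> Sh2 N" and ee: "L2_inner e e \<le> 256 * M\<^sup>2 * (1 / real N)^7"
  shows "2 * (\<Sum>j<N. slope N \<theta> j * integral (elem N j)
            (\<lambda>x. u x * (\<theta> x + e x - (f x - corrected_interpolant N f x))))
     \<le> (U + 2) * L2_inner \<theta> \<theta> + 18732 * U\<^sup>2 * M\<^sup>2 * (1 / real N)^5"
proof -
  define h where "h = 1 / real N"
  define \<rho> where "\<rho> = (\<lambda>x. f x - corrected_interpolant N f x)"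
  have h: "0 < h" "h \<le> 1" using N by (simp_all add: h_def)
  have U0: "0 \<le> U" using derivs_boundedD[OF U, of 0 0] by simp
  have u1: "continuous_on {0..1} u" "continuous_on {0..1} (deriv01 u)"
    using Ck_space_continuous[OF u(1), of 0] Ck_space_continuous[OF u(1), of 1] by simp_all
  have cont: "continuous_on {0..1} \<rho>"
    unfolding \<rho>_def using Ck_space_continuous[OF f, of 0] Sh2_continuous[OF corrected_interpolant_Sh2[OF N]]
    by (intro continuous_intros) auto
  let ?s = "slope N \<theta>"
  let ?q = "\<lambda>\<phi> j. h * (mean N \<phi> j * mean N \<phi> j) + h^3 / 12 * (slope N \<phi> j * slope N \<phi> j)"
  let ?I = "\<lambda>j f. integral (elem N j) f"
  have L2: "L2_inner \<phi> \<phi> = (\<Sum>j<N. ?q \<phi> j)" if "\<phi> \<in> Sh2 N" for \<phi>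
    unfolding L2_inner_Sh2[OF N that that] h_def ..
  note ce = continuous_on_elem[OF N]
  have A: "2 * (\<Sum>j<N. ?s j * ?I j (\<lambda>x. u x * \<theta> x)) \<le> U * L2_inner \<theta> \<theta>"
  proof -
    let ?G = "\<lambda>j x. deriv01 u x * \<theta> x + u x * ?s j"
    \<comment> \<open>Integrating \<open>(u \<theta>)' \<theta>\<close> by parts gives \<open>2 \<integral> u \<theta> \<theta>' = - \<integral> u' \<theta>\<^sup>2\<close>.\<close>
    have "(\<Sum>j<N. ?I j (\<lambda>x. ?G j x * \<theta> x)) = - (\<Sum>j<N. ?s j * ?I j (\<lambda>x. u x * \<theta> x))"
    proof (rule sum_integral_by_parts[OF N \<theta>])
      show "continuous_on {0..1} (\<lambda>x. u x * \<theta> x)" using u1 Sh2_continuous[OF \<theta>] by (intro continuous_intros)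
      fix j assume j: "j < N"
      show "continuous_on (elem N j) (\<lambda>x. deriv01 u x * \<theta> x + u x * ?s j)"
        using ce[OF j] u1 Sh2_continuous[OF \<theta>] by (intro continuous_intros) auto
      fix x assume x: "x \<in> {node N j<..<node N (Suc j)}"
      have x01: "x \<in> {0<..<1}" using x elem_subset[OF N j] node_mono[of 0 j N] node_mono[of "Suc j" N N] j N by auto
      have "(u has_real_derivative deriv01 u x) (at x)"
        using Ck_space_derivative[OF u(1), of 0 x] x01 at_within_interior[of x "{0..1}"] by simp
      moreover have "(\<theta> has_real_derivative ?s j) (at x)"
        by (rule Sh2_DERIV[OF N \<theta> j x])
      ultimately show "((\<lambda>x. u x * \<theta> x) has_real_derivative deriv01 u x * \<theta> x + u x * ?s j) (at x)"
        by (auto intro!: derivative_eq_intros)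
    qed (use u in auto)
    moreover have "?I j (\<lambda>x. ?G j x * \<theta> x) = ?I j (\<lambda>x. deriv01 u x * (\<theta> x * \<theta> x)) + ?s j * ?I j (\<lambda>x. u x * \<theta> x)"
      if j: "j < N" for j
    proof -
      have "((\<lambda>x. deriv01 u x * (\<theta> x * \<theta> x) + ?s j * (u x * \<theta> x)) has_integral
        (?I j (\<lambda>x. deriv01 u x * (\<theta> x * \<theta> x)) + ?s j * ?I j (\<lambda>x. u x * \<theta> x))) (elem N j)"
        using ce[OF j] u1 Sh2_continuous[OF \<theta>]
        by (intro has_integral_add has_integral_mult_right integrable_integral
            integrable_continuous_interval continuous_intros) auto
      then show ?thesis by (intro integral_unique) (simp add: algebra_simps)
    qed
    ultimately have "2 * (\<Sum>j<N. ?s j * ?I j (\<lambda>x. u x * \<theta> x)) = - (\<Sum>j<N. ?I j (\<lambda>x. deriv01 u x * (\<theta> x * \<theta> x)))"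
      by (simp add: sum.distrib)
    also have "\<dots> = (\<Sum>j<N. ?I j (\<lambda>x. - (deriv01 u x * (\<theta> x * \<theta> x))))"
      by (simp add: sum_negf)
    also have "\<dots> \<le> (\<Sum>j<N. ?I j (\<lambda>x. U * (\<theta> x * \<theta> x)))"
    proof (intro sum_mono integral_le integrable_continuous_interval)
      fix j assume "j \<in> {..<N}"
      then have j: "j < N" by simp
      show "continuous_on (elem N j) (\<lambda>x. - (deriv01 u x * (\<theta> x * \<theta> x)))"
        "continuous_on (elem N j) (\<lambda>x. U * (\<theta> x * \<theta> x))"
        using ce[OF j] u1 Sh2_continuous[OF \<theta>] by (intro continuous_intros; auto)+
      fix x assume "x \<in> elem N j"
      then have "x \<in> {0..1}" using elem_subset[OF N j] by blast
      then have "- deriv01 u x \<le> U" using derivs_boundedD[OF U, of 1 x] by simp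
      then show "- (deriv01 u x * (\<theta> x * \<theta> x)) \<le> U * (\<theta> x * \<theta> x)"
        using mult_right_mono[of "- deriv01 u x" U "\<theta> x * \<theta> x"] by simp
    qed
    also have "\<dots> = U * L2_inner \<theta> \<theta>"
    proof -
      have "L2_inner \<theta> \<theta> = (\<Sum>j<N. ?I j (\<lambda>x. \<theta> x * \<theta> x))"
        using ce Sh2_continuous[OF \<theta>] by (intro L2_inner_elems[OF N] continuous_intros) auto
      then show ?thesis by (simp add: sum_distrib_left)
    qed
    finally show ?thesis .
  qed
  \<comment> \<open>Of \<open>2 \<parallel>\<theta>\<parallel>\<^sup>2\<close> in the bound, one half absorbs the term with \<open>e\<close> and one half that with \<open>\<rho>\<close>.\<close>
  have B: "2 * (?s j * ?I j (\<lambda>x. u x * e x)) \<le> h^3/12 * (?s j * ?s j) + 72 * U\<^sup>2 / h\<^sup>2 * ?q e j" if j: "j < N" for j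
  proof -
    let ?c = "mean N e j" and ?t = "slope N e j"
    have "norm (?I j (\<lambda>x. u x * e x)) \<le> (U * (\<bar>?c\<bar> + \<bar>?t\<bar> * (h/2))) * (node N (Suc j) - node N j)"
    proof (rule integral_bound)
      show "node N j \<le> node N (Suc j)" using node_less[OF N, of j] by simp
      show "continuous_on (elem N j) (\<lambda>x. u x * e x)"
        using ce[OF j] u1 Sh2_continuous[OF e] by (intro continuous_intros) auto
      fix x assume x: "x \<in> elem N j"
      then have "x \<in> {0..1}" using elem_subset[OF N j] by blast
      then have "\<bar>u x\<bar> \<le> U" using derivs_boundedD[OF U, of 0 x] by simp
      moreover have "\<bar>?t * (x - midpt N j)\<bar> \<le> \<bar>?t\<bar> * (h/2)"
        unfolding abs_mult using midpt_dist[OF N x] by (intro mult_left_mono) (auto simp: h_def)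
      then have "\<bar>e x\<bar> \<le> \<bar>?c\<bar> + \<bar>?t\<bar> * (h/2)"
        using Sh2_on_elem[OF N e j x] by linarith
      ultimately show "norm (u x * e x) \<le> U * (\<bar>?c\<bar> + \<bar>?t\<bar> * (h/2))"
        unfolding real_norm_def abs_mult using U0 by (intro mult_mono) auto
    qed
    also have "node N (Suc j) - node N j = h" using N by (simp add: node_def h_def field_simps)
    finally have I: "\<bar>?I j (\<lambda>x. u x * e x)\<bar> \<le> U * (\<bar>?c\<bar> + \<bar>?t\<bar> * (h/2)) * h" by simp
    have "2 * (?s j * ?I j (\<lambda>x. u x * e x)) \<le> 2 * (\<bar>?s j\<bar> * (U * (\<bar>?c\<bar> + \<bar>?t\<bar> * (h/2)) * h))"
      using mult_left_mono[OF I abs_ge_zero[of "?s j"]] by (simp add: abs_mult[symmetric])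
    also have "\<dots> = \<bar>?s j\<bar> * (2 * U * h * \<bar>?c\<bar>) + \<bar>?s j\<bar> * (U * h\<^sup>2 * \<bar>?t\<bar>)"
      by (simp add: algebra_simps power2_eq_square)
    also have "\<bar>?s j\<bar> * (2 * U * h * \<bar>?c\<bar>) \<le> h^3/24 * (?s j * ?s j) + 24 * U\<^sup>2 / h * (?c * ?c)"
    proof -
      have "0 \<le> h^3/24 * (\<bar>?s j\<bar> - 24 * U * \<bar>?c\<bar> / h\<^sup>2)\<^sup>2" using h by simp
      also have "\<dots> = h^3/24 * (?s j * ?s j) - \<bar>?s j\<bar> * (2 * U * h * \<bar>?c\<bar>) + 24 * U\<^sup>2 / h * (?c * ?c)"
        using h by (simp add: power2_diff power2_eq_square) (simp add: field_simps eval_nat_numeral)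
      finally show ?thesis by linarith
    qed
    also have "\<bar>?s j\<bar> * (U * h\<^sup>2 * \<bar>?t\<bar>) \<le> h^3/24 * (?s j * ?s j) + 6 * U\<^sup>2 * h * (?t * ?t)"
    proof -
      have "0 \<le> h^3/24 * (\<bar>?s j\<bar> - 12 * U * \<bar>?t\<bar> / h)\<^sup>2" using h by simp
      also have "\<dots> = h^3/24 * (?s j * ?s j) - \<bar>?s j\<bar> * (U * h\<^sup>2 * \<bar>?t\<bar>) + 6 * U\<^sup>2 * h * (?t * ?t)"
        using h by (simp add: power2_diff power2_eq_square) (simp add: field_simps eval_nat_numeral)
      finally show ?thesis by linarith
    qed
    also have "24 * U\<^sup>2 / h * (?c * ?c) \<le> 72 * U\<^sup>2 / h\<^sup>2 * (h * (?c * ?c))"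
      using h U0 by (simp add: field_simps power2_eq_square zero_le_mult_iff)
    also have "6 * U\<^sup>2 * h * (?t * ?t) = 72 * U\<^sup>2 / h\<^sup>2 * (h^3 / 12 * (?t * ?t))"
      using h by (simp add: field_simps eval_nat_numeral)
    finally show ?thesis by (simp only: distrib_left) linarith
  qed
  have C: "2 * (?s j * - ?I j (\<lambda>x. u x * \<rho> x)) \<le> h^3/12 * (?s j * ?s j) + 300 * U\<^sup>2 * M\<^sup>2 * h^7" if j: "j < N" for j
  proof -
    have I: "\<bar>- ?I j (\<lambda>x. u x * \<rho> x)\<bar> \<le> 5 * U * M * h^5"
      using weighted_defect_element[OF N j f M u(1) U] by (simp add: \<rho>_def h_def)
    have "2 * (?s j * - ?I j (\<lambda>x. u x * \<rho> x)) \<le> 2 * (\<bar>?s j\<bar> * (5 * U * M * h^5))"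
      using mult_left_mono[OF I abs_ge_zero[of "?s j"]] abs_ge_self[of "?s j * - ?I j (\<lambda>x. u x * \<rho> x)"]
      unfolding abs_mult[symmetric] by linarith
    moreover have "0 \<le> h^3/12 * (\<bar>?s j\<bar> - 60 * U * M * h\<^sup>2)\<^sup>2" using h by simp
    moreover have "h^3/12 * (\<bar>?s j\<bar> - 60 * U * M * h\<^sup>2)\<^sup>2 =
      h^3/12 * (?s j * ?s j) - 2 * (\<bar>?s j\<bar> * (5 * U * M * h^5)) + 300 * U\<^sup>2 * M\<^sup>2 * h^7"
      by (simp add: power2_diff power2_eq_square) (simp add: field_simps eval_nat_numeral)
    ultimately show ?thesis by linarith
  qed
  have split: "?I j (\<lambda>x. u x * (\<theta> x + e x - \<rho> x)) = ?I j (\<lambda>x. u x * \<theta> x) + ?I j (\<lambda>x. u x * e x) - ?I j (\<lambda>x. u x * \<rho> x)"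
    if j: "j < N" for j
  proof -
    have "((\<lambda>x. u x * \<theta> x + u x * e x - u x * \<rho> x) has_integral
      (?I j (\<lambda>x. u x * \<theta> x) + ?I j (\<lambda>x. u x * e x) - ?I j (\<lambda>x. u x * \<rho> x))) (elem N j)"
      using ce[OF j] u1 cont Sh2_continuous[OF \<theta>] Sh2_continuous[OF e]
      by (intro has_integral_add has_integral_diff integrable_integral
          integrable_continuous_interval continuous_intros) auto
    then show ?thesis by (intro integral_unique) (simp add: algebra_simps)
  qed
  have "2 * (\<Sum>j<N. ?s j * ?I j (\<lambda>x. u x * (\<theta> x + e x - \<rho> x)))
    = 2 * (\<Sum>j<N. ?s j * ?I j (\<lambda>x. u x * \<theta> x)) + (\<Sum>j<N. 2 * (?s j * ?I j (\<lambda>x. u x * e x)))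
      + (\<Sum>j<N. 2 * (?s j * - ?I j (\<lambda>x. u x * \<rho> x)))"
    unfolding sum_distrib_left sum.distrib[symmetric]
  proof (intro sum.cong refl)
    fix j assume "j \<in> {..<N}"
    then have "j < N" by simp
    have "2 * (s * (a + b - c)) = 2 * (s * a) + 2 * (s * b) + 2 * (s * - c)" for s a b c :: real
      by (simp add: algebra_simps)
    then show "2 * (?s j * ?I j (\<lambda>x. u x * (\<theta> x + e x - \<rho> x)))
      = 2 * (?s j * ?I j (\<lambda>x. u x * \<theta> x)) + 2 * (?s j * ?I j (\<lambda>x. u x * e x))
        + 2 * (?s j * - ?I j (\<lambda>x. u x * \<rho> x))"
      unfolding split[OF \<open>j < N\<close>] .
  qed
  also have "\<dots> \<le> U * L2_inner \<theta> \<theta> + (\<Sum>j<N. ?q \<theta> j + 72 * U\<^sup>2 / h\<^sup>2 * ?q e j)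
      + (\<Sum>j<N. ?q \<theta> j + 300 * U\<^sup>2 * M\<^sup>2 * h^7)"
  proof (intro add_mono A sum_mono)
    fix j assume "j \<in> {..<N}"
    then have j: "j < N" by simp
    have "0 \<le> h * (mean N \<theta> j * mean N \<theta> j)" using h by simp
    then show "2 * (?s j * ?I j (\<lambda>x. u x * e x)) \<le> ?q \<theta> j + 72 * U\<^sup>2 / h\<^sup>2 * ?q e j"
      "2 * (?s j * - ?I j (\<lambda>x. u x * \<rho> x)) \<le> ?q \<theta> j + 300 * U\<^sup>2 * M\<^sup>2 * h^7"
      using B[OF j] C[OF j] by linarith+
  qed
  also have "\<dots> = (U + 2) * L2_inner \<theta> \<theta> + 72 * U\<^sup>2 / h\<^sup>2 * L2_inner e e + real N * (300 * U\<^sup>2 * M\<^sup>2 * h^7)"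
  proof -
    have "U * (\<Sum>j<N. a j) + (\<Sum>j<N. a j + k * b j) + (\<Sum>j<N. a j + c)
        = (U + 2) * (\<Sum>j<N. a j) + k * (\<Sum>j<N. b j) + real N * c" for a b :: "nat \<Rightarrow> real" and k c
      by (simp add: sum.distrib sum_distrib_left[symmetric] distrib_right)
    then show ?thesis unfolding L2[OF \<theta>] L2[OF e] .
  qed
  also have "real N * (300 * U\<^sup>2 * M\<^sup>2 * h^7) = 300 * (U\<^sup>2 * M\<^sup>2) * h^6"
    using N by (simp add: h_def eval_nat_numeral)
  also have "\<dots> \<le> 300 * (U\<^sup>2 * M\<^sup>2) * h^5"
    using h by (intro mult_left_mono power_decreasing) auto
  also have "72 * U\<^sup>2 / h\<^sup>2 * L2_inner e e \<le> 72 * U\<^sup>2 / h\<^sup>2 * (256 * M\<^sup>2 * h^7)"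
    using ee h by (intro mult_left_mono) (auto simp: h_def)
  also have "\<dots> = 18432 * (U\<^sup>2 * M\<^sup>2) * h^5"
    using h by (simp add: field_simps eval_nat_numeral)
  finally show ?thesis by (simp add: h_def \<rho>_def mult.commute mult.left_commute)
qed

lemma gronwall_zero_initial:
  fixes y y' :: "real \<Rightarrow> real"
  assumes d: "\<And>t. t \<in> {0..T} \<Longrightarrow> (y has_real_derivative y' t) (at t within {0..T})"
    and le: "\<And>t. t \<in> {0..T} \<Longrightarrow> y' t \<le> A * y t + B" and y0: "y 0 = 0"
    and A: "A \<ge> 0" and B: "B \<ge> 0" and t: "t \<in> {0..T}"
  shows "y t \<le> B * T * exp (A * T)"
proof -
  \<comment> \<open>Multiplying by the integrating factor makes \<open>z\<close> nonincreasing.\<close>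
  define z where "z = (\<lambda>s. exp (- (A * s)) * y s - B * s)"
  have dz: "(z has_real_derivative exp (- (A * s)) * (y' s - A * y s) - B) (at s within {0..t})"
    if "s \<in> {0..t}" for s
  proof -
    have "(y has_real_derivative y' s) (at s within {0..t})"
      by (rule DERIV_subset[OF d[of s]]) (use that t in auto)
    then show ?thesis unfolding z_def
      by (auto intro!: derivative_eq_intros simp: algebra_simps)
  qed
  have neg: "exp (- (A * s)) * (y' s - A * y s) - B \<le> 0" if "s \<in> {0..t}" for s
  proof -
    have "exp (- (A * s)) * (y' s - A * y s) \<le> exp (- (A * s)) * B"
      using le[of s] that t by (intro mult_left_mono) auto
    also have "\<dots> \<le> 1 * B"
      using A B that by (intro mult_right_mono) auto
    finally show ?thesis by simp
  qed
  have "z t \<le> z 0"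
  proof (cases "t = 0")
    case False
    then have "0 < t" using t by simp
    from mvt_simple[OF this, of z "\<lambda>s. (*) (exp (- (A * s)) * (y' s - A * y s) - B)"]
    obtain s where "s \<in> {0<..<t}" "z t - z 0 = (exp (- (A * s)) * (y' s - A * y s) - B) * (t - 0)"
      using dz by (auto simp: has_field_derivative_def)
    then show ?thesis
      using neg[of s] mult_nonpos_nonneg[of "exp (- (A * s)) * (y' s - A * y s) - B" t] t by auto
  qed simp
  then have "exp (- (A * t)) * y t \<le> B * t" by (simp add: z_def y0)
  then have "exp (A * t) * (exp (- (A * t)) * y t) \<le> exp (A * t) * (B * t)"
    by (intro mult_left_mono) auto
  then have "y t \<le> exp (A * t) * (B * t)"
    by (simp add: exp_minus field_simps)
  also have "\<dots> \<le> exp (A * T) * (B * T)"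
    using A B t by (intro mult_mono) (auto intro!: mult_left_mono)
  finally show ?thesis by (simp add: mult.commute)
qed

section \<open>Differentiation in time\<close>

text \<open>
  Dominated convergence for the difference quotients, which the mean value theorem bounds by \<open>K\<close>.
  Continuity of the norm \<open>t \<mapsto> \<parallel>\<eta>(t)\<parallel>\<close> on the compact time interval provides such a bound.
\<close>
lemma L2_inner_has_derivative:
  fixes f f' :: "real \<Rightarrow> real \<Rightarrow> real"
  assumes t: "t \<in> {0..T}"
    and fc: "\<And>s. s \<in> {0..T} \<Longrightarrow> continuous_on {0..1} (f s)"
    and f'c: "continuous_on {0..1} (f' t)" and qc: "continuous_on {0..1} q"
    and d: "\<And>s x. s \<in> {0..T} \<Longrightarrow> x \<in> {0..1} \<Longrightarrow>
        ((\<lambda>s. f s x) has_real_derivative f' s x) (at s within {0..T})"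
    and K: "\<And>s x. s \<in> {0..T} \<Longrightarrow> x \<in> {0..1} \<Longrightarrow> \<bar>f' s x\<bar> \<le> K"
  shows "((\<lambda>s. L2_inner (f s) q) has_real_derivative L2_inner (f' t) q) (at t within {0..T})"
proof -
  let ?F = "\<lambda>s. L2_inner (f s) q"
  have "compact (q ` {0..1})" by (rule compact_continuous_image[OF qc]) simp
  then obtain Q where Q: "\<And>x. x \<in> {0..1} \<Longrightarrow> \<bar>q x\<bar> \<le> Q"
    using compact_imp_bounded bounded_iff by (metis image_eqI real_norm_def)
  have lim: "(\<lambda>n. (?F (X n) - ?F t) / (X n - t)) \<longlonglongrightarrow> L2_inner (f' t) q"
    if X: "\<And>n. X n \<in> {0..T} - {t}" and Xt: "X \<longlonglongrightarrow> t" for X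
  proof -
    let ?g = "\<lambda>n x. (f (X n) x - f t x) / (X n - t) * q x"
    have int: "(?g n has_integral (?F (X n) - ?F t) / (X n - t)) {0..1}" for n
    proof -
      have "((\<lambda>x. f s x * q x) has_integral ?F s) {0..1}" if "s \<in> {0..T}" for s
        unfolding L2_inner_eq_integral[OF fc[OF that] qc]
        by (intro integrable_integral integrable_continuous_interval continuous_intros fc[OF that] qc)
      from has_integral_mult_right[OF has_integral_diff[OF this[of "X n"] this[OF t]], of "1 / (X n - t)"]
      show ?thesis using X[of n] by (simp add: field_simps)
    qed
    have "(\<lambda>n. integral {0..1} (?g n)) \<longlonglongrightarrow> integral {0..1} (\<lambda>x. f' t x * q x)"
    proof (rule dominated_convergence(2))
      show "?g n integrable_on {0..1}" for n using int by blast
      show "(\<lambda>x. K * Q) integrable_on {0..1::real}"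
        by (intro integrable_continuous_interval continuous_on_const)
      show "norm (?g n x) \<le> K * Q" if x: "x \<in> {0..1}" for n x
      proof -
        have "norm (f (X n) x - f t x) \<le> K * norm (X n - t)"
          by (rule field_differentiable_bound[of "{0..T}" "\<lambda>s. f s x" "\<lambda>s. f' s x"])
            (use d K x X[of n] t in auto)
        then have "\<bar>(f (X n) x - f t x) / (X n - t)\<bar> \<le> K"
          using X[of n] by (simp add: abs_divide divide_le_eq)
        then show ?thesis
          unfolding real_norm_def abs_mult using Q[OF x] K[OF t x] by (intro mult_mono) auto
      qed
      show "(\<lambda>n. ?g n x) \<longlonglongrightarrow> f' t x * q x" if x: "x \<in> {0..1}" for x
      proof (intro tendsto_mult tendsto_const)
        have "((\<lambda>s. (f s x - f t x) / (s - t)) \<longlongrightarrow> f' t x) (at t within {0..T})"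
          using d[OF t x] by (simp add: has_field_derivative_iff)
        then show "(\<lambda>n. (f (X n) x - f t x) / (X n - t)) \<longlonglongrightarrow> f' t x"
          using X Xt unfolding tendsto_at_iff_sequentially by (auto simp: o_def)
      qed
    qed
    then show ?thesis
      unfolding integral_unique[OF int] L2_inner_eq_integral[OF f'c qc] .
  qed
  then show ?thesis
    unfolding has_field_derivative_iff tendsto_at_iff_sequentially by (auto simp: o_def)
qed

lemma DERIV_unique_within_interval:
  fixes f :: "real \<Rightarrow> real"
  assumes "a < b" "x \<in> {a..b}"
    and "(f has_real_derivative d) (at x within {a..b})" "(f has_real_derivative d') (at x within {a..b})"
  shows "d = d'"
  by (rule vector_derivative_unique_within_closed_interval[of a b x f])
     (use assms in \<open>simp_all add: has_real_derivative_iff_has_vector_derivative\<close>)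

text \<open>
  The values at the nodes determine everything: \<open>\<phi> s x\<close> is a fixed linear combination of them, and
  hence so is its time derivative.
\<close>
lemma Sh2_time_derivative:
  assumes N: "N > 0" and T: "T > 0" and t: "t \<in> {0..T}"
    and \<phi>: "\<And>s. s \<in> {0..T} \<Longrightarrow> \<phi> s \<in> Sh2 N"
    and d: "\<And>x. x \<in> {0..1} \<Longrightarrow> ((\<lambda>s. \<phi> s x) has_real_derivative \<phi>' x) (at t within {0..T})"
  shows "\<phi>' \<in> Sh2 N"
    and "q \<in> Sh2 N \<Longrightarrow> ((\<lambda>s. L2_inner (\<phi> s) q) has_real_derivative L2_inner \<phi>' q) (at t within {0..T})"
proof -
  have nd: "node N i \<in> {0..1}" if "i \<le> N" for i
    using node_mono[of 0 i N] node_mono[of i N N] that N by auto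
  have "\<phi>' x = interpolant N \<phi>' x" if x: "x \<in> {0..1}" for x
  proof -
    have "((\<lambda>s. interpolant N (\<phi> s) x) has_real_derivative interpolant N \<phi>' x) (at t within {0..T})"
      unfolding interpolant_def by (intro DERIV_sum DERIV_cmult_right d nd) simp
    then have "((\<lambda>s. \<phi> s x) has_real_derivative interpolant N \<phi>' x) (at t within {0..T})"
      by (rule has_field_derivative_transform_within[of _ _ _ _ 1])
         (use t interpolant_Sh2_id[OF N \<phi> x] in auto)
    with d[OF x] show ?thesis by (rule DERIV_unique_within_interval[OF T t])
  qed
  then show S: "\<phi>' \<in> Sh2 N"
    by (intro Sh2_cong[OF N interpolant_Sh2[OF N]])
  assume q: "q \<in> Sh2 N"
  have m: "((\<lambda>s. mean N (\<phi> s) j) has_real_derivative mean N \<phi>' j) (at t within {0..T})"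
    "((\<lambda>s. slope N (\<phi> s) j) has_real_derivative slope N \<phi>' j) (at t within {0..T})" if "j < N" for j
    unfolding mean_def slope_def using that
    by (intro DERIV_cdivide DERIV_cmult_right DERIV_add DERIV_diff d nd; simp)+
  let ?L = "\<lambda>\<psi>. \<Sum>j<N. (1 / real N) * (mean N \<psi> j * mean N q j)
            + (1 / real N)^3 / 12 * (slope N \<psi> j * slope N q j)"
  have "((\<lambda>s. ?L (\<phi> s)) has_real_derivative ?L \<phi>') (at t within {0..T})"
    by (intro DERIV_sum DERIV_add DERIV_cmult DERIV_cmult_right m) simp_all
  then have "((\<lambda>s. L2_inner (\<phi> s) q) has_real_derivative ?L \<phi>') (at t within {0..T})"
    by (rule has_field_derivative_transform_within[of _ _ _ _ 1])
       (use t L2_inner_Sh2[OF N \<phi> q] in auto)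
  then show "((\<lambda>s. L2_inner (\<phi> s) q) has_real_derivative L2_inner \<phi>' q) (at t within {0..T})"
    unfolding L2_inner_Sh2[OF N S q] .
qed

lemma transport_solution_time_derivative:
  assumes sol: "transport_solution T u \<eta>0 \<eta>" and t: "t \<in> {0..T}" and x: "x \<in> {0..1}"
    and u: "u \<in> Ck_space 1" and \<eta>: "\<eta> t \<in> Ck_space 1"
  shows "((\<lambda>s. \<eta> s x) has_real_derivative - (deriv01 u x * \<eta> t x + u x * deriv01 (\<eta> t) x)) (at t within {0..T})"
proof -
  obtain a b where a: "((\<lambda>s. \<eta> s x) has_real_derivative a) (at t within {0..T})"
    and b: "((\<lambda>y. u y * \<eta> t y) has_real_derivative b) (at x within {0..1})" and ab: "a + b = 0"
    using sol t x unfolding transport_solution_def by blast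
  have "((\<lambda>y. u y * \<eta> t y) has_real_derivative deriv01 u x * \<eta> t x + u x * deriv01 (\<eta> t) x) (at x within {0..1})"
    using Ck_space_derivative[OF u, of 0 x] Ck_space_derivative[OF \<eta>, of 0 x] x
    by (auto intro!: derivative_eq_intros)
  with b have "b = deriv01 u x * \<eta> t x + u x * deriv01 (\<eta> t) x"
    by (rule DERIV_unique_within_interval[OF zero_less_one x])
  then have "a = - (deriv01 u x * \<eta> t x + u x * deriv01 (\<eta> t) x)" using ab by linarith
  then show ?thesis using a by simp
qed

section \<open>The error estimate\<close>

text \<open>
  With \<open>\<theta>\<close> the projection of the error \<open>E = \<eta>\<^sub>h - \<eta>\<close>, the coefficients of \<open>\<theta>\<close> in an orthonormal basis
  have the time derivatives \<open>\<integral> u E q\<^sub>k'\<close>, and \<open>\<theta>\<close> is initially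
  zero. The energy estimate and Gronwall's inequality bound \<open>\<parallel>\<theta>\<parallel>\<^sup>2\<close> by a multiple of \<open>h\<^sup>5\<close>. The 42 is
  \<open>40 + 2\<close>, from \<open>e\<close> and from the defect of the corrected interpolant.
\<close>
lemma semidiscrete_error_bound:
  assumes T: "T > 0" and u: "u \<in> Ck0_space 2" and U: "derivs_bounded 2 u U"
    and sol: "transport_solution T u \<eta>0 \<eta>"
    and \<eta>: "\<And>t. t \<in> {0..T} \<Longrightarrow> \<eta> t \<in> Ck_space 4"
    and M: "\<And>t. t \<in> {0..T} \<Longrightarrow> derivs_bounded 4 (\<eta> t) M"
    and N: "N > 0" and sd: "semidiscrete_solution N T u \<eta>0 \<eta>h"
    and t: "t \<in> {0..T}" and x: "x \<in> {0..1}"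
  shows "\<bar>\<eta> t x - \<eta>h t x\<bar>
    \<le> (sqrt (6 * (18732 * U\<^sup>2 * M\<^sup>2) * T * exp ((U + 2) * T)) + 42 * M) * (1 / real N)\<^sup>2"
proof -
  define h where "h = 1 / real N"
  have h: "0 < h" "h \<le> 1" "real N = 1 / h" using N by (simp_all add: h_def)
  have M0: "0 \<le> M" and U0: "0 \<le> U"
    using derivs_boundedD[OF M[OF t], of 0 0] derivs_boundedD[OF U, of 0 0] by simp_all
  have u2: "u \<in> Ck_space 2" "u 0 = 0" "u 1 = 0" using u by (simp_all add: Ck0_space_def)
  have u1: "u \<in> Ck_space 1" by (rule Ck_space_mono[OF u2(1)]) simp
  have \<eta>1: "\<eta> s \<in> Ck_space 1" if "s \<in> {0..T}" for s by (rule Ck_space_mono[OF \<eta>[OF that]]) simp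
  have \<eta>c: "continuous_on {0..1} (\<eta> s)" "continuous_on {0..1} (deriv01 (\<eta> s))" if "s \<in> {0..T}" for s
    using Ck_space_continuous[OF \<eta>1[OF that], of 0] Ck_space_continuous[OF \<eta>1[OF that], of 1] by simp_all
  have uc: "continuous_on {0..1} u" "continuous_on {0..1} (deriv01 u)"
    using Ck_space_continuous[OF u1, of 0] Ck_space_continuous[OF u1, of 1] by simp_all
  have ub: "\<bar>u x\<bar> \<le> U" "\<bar>deriv01 u x\<bar> \<le> U" if "x \<in> {0..1}" for x
    using derivs_boundedD[OF U, of 0 x] derivs_boundedD[OF U, of 1 x] that by simp_all
  have \<eta>b: "\<bar>\<eta> s x\<bar> \<le> M" "\<bar>deriv01 (\<eta> s) x\<bar> \<le> M" if "s \<in> {0..T}" "x \<in> {0..1}" for s x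
    using derivs_boundedD[OF M[OF that(1)], of 0 x] derivs_boundedD[OF M[OF that(1)], of 1 x] that by simp_all
  obtain \<eta>ht where Sh: "\<And>s. s \<in> {0..T} \<Longrightarrow> \<eta>h s \<in> Sh2 N"
    and ht: "\<And>s x. s \<in> {0..T} \<Longrightarrow> x \<in> {0..1} \<Longrightarrow> ((\<lambda>s. \<eta>h s x) has_real_derivative \<eta>ht s x) (at s within {0..T})"
    and gal: "\<And>s \<phi>. s \<in> {0..T} \<Longrightarrow> \<phi> \<in> Sh2 N \<Longrightarrow>
       L2_inner (\<eta>ht s) \<phi> + L2_inner (deriv (\<lambda>y. u y * \<eta>h s y)) \<phi> = 0"
    and ini: "is_L2_projection N \<eta>0 (\<eta>h 0)"
    using sd unfolding semidiscrete_solution_def by blast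
  define \<eta>t where "\<eta>t = (\<lambda>s x. - (deriv01 u x * \<eta> s x + u x * deriv01 (\<eta> s) x))"
  have \<eta>t: "((\<lambda>s. \<eta> s x) has_real_derivative \<eta>t s x) (at s within {0..T})"
    if "s \<in> {0..T}" "x \<in> {0..1}" for s x
    unfolding \<eta>t_def by (rule transport_solution_time_derivative[OF sol that u1 \<eta>1[OF that(1)]])
  have \<eta>tb: "\<bar>\<eta>t s x\<bar> \<le> 2 * (U * M)" if "s \<in> {0..T}" "x \<in> {0..1}" for s x
  proof -
    have "\<bar>deriv01 u x * \<eta> s x\<bar> \<le> U * M" "\<bar>u x * deriv01 (\<eta> s) x\<bar> \<le> U * M"
      unfolding abs_mult using ub[OF that(2)] \<eta>b[OF that] U0 by (intro mult_mono; simp)+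
    then show ?thesis unfolding \<eta>t_def by linarith
  qed
  have \<eta>tc: "continuous_on {0..1} (\<eta>t s)" if "s \<in> {0..T}" for s
    unfolding \<eta>t_def using uc \<eta>c[OF that] by (intro continuous_intros)
  obtain m :: nat and q where basis: "orthonormal_basis_Sh2 N m q"
    using orthonormal_basis_Sh2_exists[OF N] by blast
  note q = orthonormal_basis_Sh2D(1)[OF basis]
  define E where "E = (\<lambda>s x. \<eta>h s x - \<eta> s x)"
  define \<alpha> where "\<alpha> = (\<lambda>k s. L2_inner (E s) (q k))"
  define \<theta> where "\<theta> = (\<lambda>s x. \<Sum>k<m. \<alpha> k s * q k x)"
  define W where "W = (\<lambda>s. corrected_interpolant N (\<eta> s))"
  define e where "e = (\<lambda>s x. \<eta>h s x - \<theta> s x - W s x)"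
  define y where "y = (\<lambda>s. \<Sum>k<m. (\<alpha> k s)\<^sup>2)"
  define J where "J = (\<lambda>s j. integral (elem N j) (\<lambda>x. u x * E s x))"
  have hc: "continuous_on {0..1} (\<eta>h s)" if "s \<in> {0..T}" for s by (rule Sh2_continuous[OF Sh[OF that]])
  have Ec: "continuous_on {0..1} (E s)" if "s \<in> {0..T}" for s
    unfolding E_def using hc[OF that] \<eta>c[OF that] by (intro continuous_intros)
  have qc: "continuous_on {0..1} (q k)" if "k < m" for k by (rule Sh2_continuous[OF q[OF that]])
  have W: "W s \<in> Sh2 N" for s unfolding W_def by (rule corrected_interpolant_Sh2[OF N])
  have \<theta>: "\<theta> s \<in> Sh2 N" for s unfolding \<theta>_def by (rule Sh2_sum[OF N]) (use q in auto)
  have e: "e s \<in> Sh2 N" if "s \<in> {0..T}" for s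
    unfolding e_def by (intro Sh2_diff[OF N] Sh[OF that] \<theta> W)
  have \<theta>E: "L2_inner (\<theta> s) \<phi> = L2_inner (E s) \<phi>" if "s \<in> {0..T}" "\<phi> \<in> Sh2 N" for s \<phi>
    unfolding \<theta>_def \<alpha>_def by (rule L2_inner_projection(1)[OF basis Ec[OF that(1)] that(2)])
  have \<theta>\<theta>: "L2_inner (\<theta> s) (\<theta> s) = y s" if "s \<in> {0..T}" for s
    unfolding \<theta>_def \<alpha>_def y_def by (rule L2_inner_projection(2)[OF basis Ec[OF that]])
  \<comment> \<open>The scheme and the equation are both tested with \<open>q k\<close>; the flux terms combine to \<open>\<integral> u E (q k)'\<close>.\<close>
  have d\<alpha>: "((\<lambda>s. \<alpha> k s) has_real_derivative (\<Sum>j<N. slope N (q k) j * J s j)) (at s within {0..T})"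
    if k: "k < m" and s: "s \<in> {0..T}" for k s
  proof -
    have 1: "((\<lambda>s. L2_inner (\<eta>h s) (q k)) has_real_derivative L2_inner (\<eta>ht s) (q k)) (at s within {0..T})"
      by (rule Sh2_time_derivative(2)[OF N T s Sh ht[OF s] q[OF k]])
    have 2: "((\<lambda>s. L2_inner (\<eta> s) (q k)) has_real_derivative L2_inner (\<eta>t s) (q k)) (at s within {0..T})"
      by (rule L2_inner_has_derivative[OF s \<eta>c(1) \<eta>tc[OF s] qc[OF k] \<eta>t \<eta>tb])
    have "L2_inner (\<eta>ht s) (q k) = (\<Sum>j<N. slope N (q k) j * integral (elem N j) (\<lambda>x. u x * \<eta>h s x))"
      using gal[OF s q[OF k]] L2_inner_flux_Sh2[OF N u1 u2(2,3) Sh[OF s] q[OF k]] by linarith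
    moreover have "L2_inner (\<eta>t s) (q k) = (\<Sum>j<N. slope N (q k) j * integral (elem N j) (\<lambda>x. u x * \<eta> s x))"
    proof -
      have "continuous_on {0..1} (\<lambda>x. deriv01 u x * \<eta> s x + u x * deriv01 (\<eta> s) x)"
        using uc \<eta>c[OF s] by (intro continuous_intros)
      from L2_inner_scale_left[OF this qc[OF k], of "-1"]
      show ?thesis using L2_inner_flux_continuous[OF N u1 u2(2,3) \<eta>1[OF s] q[OF k]] by (simp add: \<eta>t_def)
    qed
    moreover have "J s j = integral (elem N j) (\<lambda>x. u x * \<eta>h s x) - integral (elem N j) (\<lambda>x. u x * \<eta> s x)"
      if j: "j < N" for j
    proof -
      have "J s j = integral (elem N j) (\<lambda>x. u x * \<eta>h s x - u x * \<eta> s x)"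
        by (simp add: J_def E_def right_diff_distrib)
      also have "\<dots> = integral (elem N j) (\<lambda>x. u x * \<eta>h s x) - integral (elem N j) (\<lambda>x. u x * \<eta> s x)"
        by (intro integral_diff integrable_continuous_interval continuous_on_mult
            continuous_on_elem[OF N j] uc hc[OF s] \<eta>c[OF s])
      finally show ?thesis .
    qed
    ultimately have "L2_inner (\<eta>ht s) (q k) - L2_inner (\<eta>t s) (q k) = (\<Sum>j<N. slope N (q k) j * J s j)"
      by (simp add: sum_subtractf right_diff_distrib)
    with DERIV_diff[OF 1 2]
    have "((\<lambda>s. L2_inner (\<eta>h s) (q k) - L2_inner (\<eta> s) (q k)) has_real_derivative
        (\<Sum>j<N. slope N (q k) j * J s j)) (at s within {0..T})" by simp
    then show ?thesis
    proof (rule has_field_derivative_transform_within[OF _ zero_less_one s])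
      fix r assume r: "r \<in> {0..T}"
      show "L2_inner (\<eta>h r) (q k) - L2_inner (\<eta> r) (q k) = \<alpha> k r"
        unfolding \<alpha>_def E_def by (rule L2_inner_diff_left[OF hc[OF r] \<eta>c(1)[OF r] qc[OF k], symmetric])
    qed
  qed
  have dy: "(y has_real_derivative 2 * (\<Sum>j<N. slope N (\<theta> s) j * J s j)) (at s within {0..T})"
    if s: "s \<in> {0..T}" for s
  proof -
    have "(y has_real_derivative (\<Sum>k<m. 2 * (\<alpha> k s * (\<Sum>j<N. slope N (q k) j * J s j)))) (at s within {0..T})"
      unfolding y_def
    proof (rule DERIV_sum)
      fix k assume "k \<in> {..<m}"
      then have "k < m" by simp
      from DERIV_power[OF d\<alpha>[OF this s], of 2]
      show "((\<lambda>s. (\<alpha> k s)\<^sup>2) has_real_derivative 2 * (\<alpha> k s * (\<Sum>j<N. slope N (q k) j * J s j))) (at s within {0..T})"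
        by (simp add: mult.commute mult.left_commute)
    qed
    moreover have "(\<Sum>k<m. \<alpha> k s * (\<Sum>j<N. slope N (q k) j * J s j)) = (\<Sum>j<N. slope N (\<theta> s) j * J s j)"
    proof -
      have "slope N (\<theta> s) j = (\<Sum>k<m. \<alpha> k s * slope N (q k) j)" for j
        by (simp add: slope_def \<theta>_def sum_subtractf[symmetric] sum_distrib_left sum_distrib_right algebra_simps)
      then have "(\<Sum>j<N. slope N (\<theta> s) j * J s j) = (\<Sum>j<N. \<Sum>k<m. \<alpha> k s * slope N (q k) j * J s j)"
        by (simp add: sum_distrib_right)
      also have "\<dots> = (\<Sum>k<m. \<Sum>j<N. \<alpha> k s * slope N (q k) j * J s j)"
        by (rule sum.swap)
      finally show ?thesis by (simp add: sum_distrib_left mult.assoc)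
    qed
    ultimately show ?thesis by (simp only: sum_distrib_left[symmetric])
  qed
  \<comment> \<open>\<open>E - \<theta>\<close> is orthogonal to \<open>e\<close>, which leaves \<open>(e, e) = (\<rho>, e)\<close>.\<close>
  have ee: "L2_inner (e s) (e s) \<le> 256 * M\<^sup>2 * (1 / real N)^7" if s: "s \<in> {0..T}" for s
  proof (rule projection_defect_bound[OF N \<eta>[OF s] M[OF s] e[OF s]])
    note ec = Sh2_continuous[OF e[OF s]] and \<theta>c = Sh2_continuous[OF \<theta>[of s]] and Wc = Sh2_continuous[OF W[of s]]
    have "L2_inner (e s) (e s) = L2_inner (\<eta>h s) (e s) - L2_inner (\<theta> s) (e s) - L2_inner (W s) (e s)"
      using L2_inner_diff_left[OF continuous_on_diff[OF hc[OF s] \<theta>c] Wc ec] L2_inner_diff_left[OF hc[OF s] \<theta>c ec]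
      by (simp add: e_def)
    also have "L2_inner (\<theta> s) (e s) = L2_inner (\<eta>h s) (e s) - L2_inner (\<eta> s) (e s)"
      using \<theta>E[OF s e[OF s]] L2_inner_diff_left[OF hc[OF s] \<eta>c(1)[OF s] ec] by (simp add: E_def)
    finally show "L2_inner (e s) (e s) = L2_inner (\<lambda>x. \<eta> s x - corrected_interpolant N (\<eta> s) x) (e s)"
      using L2_inner_diff_left[OF \<eta>c(1)[OF s] Wc ec] by (simp add: W_def)
  qed
  have Eeq: "E s x = \<theta> s x + e s x - (\<eta> s x - corrected_interpolant N (\<eta> s) x)" for s x
    by (simp add: E_def e_def W_def)
  have rate: "2 * (\<Sum>j<N. slope N (\<theta> s) j * J s j) \<le> (U + 2) * y s + 18732 * U\<^sup>2 * M\<^sup>2 * h^5"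
    if s: "s \<in> {0..T}" for s
    using energy_rate_bound[OF N \<eta>[OF s] M[OF s] u2 U \<theta>[of s] e[OF s] ee[OF s]]
    by (simp add: J_def Eeq \<theta>\<theta>[OF s] h_def)
  have y0: "y 0 = 0"
  proof -
    have z: "0 \<in> {0..T}" using T by simp
    have "\<alpha> k 0 = 0" if k: "k < m" for k
    proof -
      have "L2_inner (\<eta> 0) (q k) = L2_inner \<eta>0 (q k)"
        by (rule L2_inner_cong) (use sol in \<open>simp add: transport_solution_def\<close>)
      moreover have "L2_inner (\<eta>h 0) (q k) = L2_inner \<eta>0 (q k)"
        using ini q[OF k] by (simp add: is_L2_projection_def)
      ultimately show ?thesis
        using L2_inner_diff_left[OF hc[OF z] \<eta>c(1)[OF z] qc[OF k]] by (simp add: \<alpha>_def E_def)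
    qed
    then show ?thesis by (simp add: y_def)
  qed
  have yb: "y t \<le> (18732 * U\<^sup>2 * M\<^sup>2 * h^5) * T * exp ((U + 2) * T)"
    by (rule gronwall_zero_initial[OF dy rate y0 _ _ t]) (use U0 h in auto)
  define D where "D = 6 * (18732 * U\<^sup>2 * M\<^sup>2) * T * exp ((U + 2) * T)"
  have D0: "0 \<le> D" using T by (simp add: D_def)
  have "(\<theta> t x)\<^sup>2 \<le> 6 * real N * y t"
    using Sh2_sup_bound[OF N \<theta> x, of t] \<theta>\<theta>[OF t] by simp
  also have "\<dots> \<le> 6 * real N * ((18732 * U\<^sup>2 * M\<^sup>2 * h^5) * T * exp ((U + 2) * T))"
    by (intro mult_left_mono yb) simp
  also have "\<dots> = D * h^4"
    unfolding h(3) D_def using h(1) by (simp add: field_simps eval_nat_numeral)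
  also have "\<dots> = (sqrt D * h\<^sup>2)\<^sup>2"
    using D0 by (simp add: power_mult_distrib flip: power_mult)
  finally have b\<theta>: "\<bar>\<theta> t x\<bar> \<le> sqrt D * h\<^sup>2"
    using D0 h by (intro abs_le_square_iff[THEN iffD2, of "\<theta> t x" "sqrt D * h\<^sup>2", THEN order_trans]) auto
  have "(e t x)\<^sup>2 \<le> 6 * real N * (256 * M\<^sup>2 * h^7)"
  proof -
    have "(e t x)\<^sup>2 \<le> 6 * real N * L2_inner (e t) (e t)" by (rule Sh2_sup_bound[OF N e[OF t] x])
    also have "\<dots> \<le> 6 * real N * (256 * M\<^sup>2 * h^7)"
      using ee[OF t] by (intro mult_left_mono) (auto simp: h_def)
    finally show ?thesis .
  qed
  also have "\<dots> = 1536 * (M\<^sup>2 * h^6)"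
    unfolding h(3) using h(1) by (simp add: field_simps eval_nat_numeral)
  also have "\<dots> \<le> 1600 * (M\<^sup>2 * h^4)"
  proof -
    have "M\<^sup>2 * h^6 \<le> M\<^sup>2 * h^4" using h by (intro mult_left_mono power_decreasing) auto
    moreover have "0 \<le> M\<^sup>2 * h^4" using h by simp
    ultimately show ?thesis by linarith
  qed
  also have "\<dots> = (40 * M * h\<^sup>2)\<^sup>2"
    by (simp add: power_mult_distrib flip: power_mult)
  finally have be: "\<bar>e t x\<bar> \<le> 40 * M * h\<^sup>2"
    using M0 h by (intro abs_le_square_iff[THEN iffD2, of "e t x" "40 * M * h\<^sup>2", THEN order_trans]) auto
  obtain j where j: "j < N" "x \<in> elem N j" using elem_cover[OF N x] by blast
  have b\<rho>: "\<bar>\<eta> t x - corrected_interpolant N (\<eta> t) x\<bar> \<le> 2 * M * h\<^sup>2"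
    using corrected_interpolant_error(1)[OF N j(1) \<eta>[OF t] M[OF t] j(2)] by (simp add: h_def)
  have "\<bar>\<eta> t x - \<eta>h t x\<bar> = \<bar>E t x\<bar>" by (simp add: E_def)
  also have "\<dots> \<le> sqrt D * h\<^sup>2 + 40 * M * h\<^sup>2 + 2 * M * h\<^sup>2"
    unfolding Eeq using b\<theta> be b\<rho> by linarith
  also have "\<dots> = (sqrt D + 42 * M) * h\<^sup>2" by (simp add: algebra_simps)
  finally show ?thesis unfolding D_def h_def .
qed

lemma Linf_norm_le:
  assumes "continuous_on {0..1} f" "\<And>x. x \<in> {0..1} \<Longrightarrow> \<bar>f x\<bar> \<le> c"
  shows "Linf_norm f \<le> ereal c"
  unfolding Linf_norm_def
proof (rule esssup_I)
  have "continuous_on {0<..<1} (\<lambda>x. \<bar>f x\<bar>)"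
    by (intro continuous_intros continuous_on_subset[OF assms(1)]) auto
  then have "(\<lambda>x. \<bar>f x\<bar>) \<in> borel_measurable (lebesgue_on {0<..<1})"
    by (intro continuous_imp_measurable_on_sets_lebesgue) auto
  then show "(\<lambda>x. ereal \<bar>f x\<bar>) \<in> borel_measurable (lebesgue_on {0<..<1})" by simp
  show "AE x in lebesgue_on {0<..<1}. ereal \<bar>f x\<bar> \<le> ereal c"
    by (rule AE_I2) (use assms(2) in auto)
qed

theorem proposition6p2:
  fixes T :: real and u \<eta>0 :: "real \<Rightarrow> real" and \<eta> :: "real \<Rightarrow> real \<Rightarrow> real"
  assumes "T > 0"
    and "u \<in> Ck0_space 2"
    and "transport_solution T u \<eta>0 \<eta>"
    and "\<eta> \<in> C_time_Ck T 4"
  shows "\<exists>C. \<forall>N\<ge>2. \<forall>\<eta>h. semidiscrete_solution N T u \<eta>0 \<eta>h \<longrightarrow>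
           (\<forall>t\<in>{0..T}. Linf_norm (\<lambda>x. \<eta> t x - \<eta>h t x) \<le> ereal (C * (1 / real N)\<^sup>2))"
proof -
  obtain M where M: "\<And>t. t \<in> {0..T} \<Longrightarrow> derivs_bounded 4 (\<eta> t) M"
    using C_time_Ck_bounded[OF assms(4)] by blast
  have \<eta>: "\<eta> t \<in> Ck_space 4" if "t \<in> {0..T}" for t
    using assms(4) that by (simp add: C_time_Ck_def)
  have "derivs_bounded 2 u (Ck_norm 2 u)"
    using Ck_norm_bound[of u 2] assms(2) by (simp add: derivs_bounded_def Ck0_space_def)
  note bound = semidiscrete_error_bound[OF assms(1,2) this assms(3) \<eta> M]
  define C where "C = sqrt (6 * (18732 * (Ck_norm 2 u)\<^sup>2 * M\<^sup>2) * T * exp ((Ck_norm 2 u + 2) * T)) + 42 * M"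
  have "Linf_norm (\<lambda>x. \<eta> t x - \<eta>h t x) \<le> ereal (C * (1 / real N)\<^sup>2)"
    if N: "N \<ge> 2" and sd: "semidiscrete_solution N T u \<eta>0 \<eta>h" and t: "t \<in> {0..T}" for N \<eta>h t
  proof (rule Linf_norm_le)
    have "\<eta>h t \<in> Sh2 N" using sd t by (simp add: semidiscrete_solution_def)
    then show "continuous_on {0..1} (\<lambda>x. \<eta> t x - \<eta>h t x)"
      using Ck_space_continuous[OF \<eta>[OF t], of 0] Sh2_continuous by (intro continuous_on_diff) auto
    show "\<bar>\<eta> t x - \<eta>h t x\<bar> \<le> C * (1 / real N)\<^sup>2" if "x \<in> {0..1}" for x
      unfolding C_def by (rule bound[OF _ _ _ sd t that]) (use N in auto)
  qed
  then show ?thesis by blast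
qed

end
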